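(* Let $\mathcal H$ be a complex Hilbert space (of arbitrary dimension), let $T$ be a bounded operator on $\mathcal H$ with $W(T)\subset\mathcal S_{\pi/4}=\{re^{i\theta}:r\ge0,\ |\theta|\le\pi/4\}$, and let $c\in\mathbb C$ with $|c|\le\frac{19}{20}$. Then $$\Bigl\|\bigl((T^2-I)^2+\bar c(T^2+I)^2\bigr)\bigl((T^2+I)^2+c(T^2-I)^2\bigr)^{-1}\Bigr\|\le\sqrt2 .$$ The rational functions $$z\mapsto\frac{(z-1)^2+\bar c(z+1)^2}{(z+1)^2+c(z-1)^2}$$ (evaluated above at $z=T^2$) are degree-two Blaschke products on the right half-plane $\{\Re z>0\}$; for example, at $c=i/2$ the zeros are $1+2i$ and $\frac{1-2i}{5}$.
   Context: $W(T)=\{\langle Tx,x\rangle:\|x\|=1\}$ is the numerical range. A degree-two Blaschke product on the right half-plane is a function $\omega\,\frac{z-\zeta_1}{z+\overline{\zeta_1}}\cdot\frac{z-\zeta_2}{z+\overline{\zeta_2}}$ with $|\omega|=1$ and $\Re\zeta_1,\Re\zeta_2>0$. *)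

theory Defs
  imports "HOL-Analysis.Analysis"
begin

text \<open>
  Complex inner product spaces. The real normed structure is inherited from the library, so that
  \<open>bounded_linear\<close> and \<open>onorm\<close> are available; the axioms tie it to the complex structure. The inner
  product is linear in its first and conjugate-linear in its second argument.
\<close>

class complex_inner = real_normed_vector +
  fixes scaleC :: "complex \<Rightarrow> 'a \<Rightarrow> 'a"  (infixr \<open>*\<^sub>C\<close> 75)
    and cinner :: "'a \<Rightarrow> 'a \<Rightarrow> complex"
  assumes scaleC_add_right: "a *\<^sub>C (x + y) = a *\<^sub>C x + a *\<^sub>C y"
    and scaleC_add_left: "(a + b) *\<^sub>C x = a *\<^sub>C x + b *\<^sub>C x"
    and scaleC_scaleC: "a *\<^sub>C b *\<^sub>C x = (a * b) *\<^sub>C x"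
    and scaleC_one: "1 *\<^sub>C x = x"
    and scaleR_scaleC: "r *\<^sub>R x = complex_of_real r *\<^sub>C x"
    and cinner_commute: "cinner x y = cnj (cinner y x)"
    and cinner_add_left: "cinner (x + y) z = cinner x z + cinner y z"
    and cinner_scaleC_left: "cinner (a *\<^sub>C x) y = a * cinner x y"
    and cinner_ge_zero: "0 \<le> Re (cinner x x)"
    and cinner_eq_zero_iff: "cinner x x = 0 \<longleftrightarrow> x = 0"
    and norm_eq_sqrt_cinner: "norm x = sqrt (Re (cinner x x))"

class chilbert_space = complex_inner + complete_space

instantiation complex :: chilbert_space
begin

definition scaleC_complex :: "complex \<Rightarrow> complex \<Rightarrow> complex"
  where "scaleC_complex a x = a * x"

definition cinner_complex :: "complex \<Rightarrow> complex \<Rightarrow> complex"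
  where "cinner_complex x y = x * cnj y"

instance
proof
  fix x :: complex
  show "norm x = sqrt (Re (cinner x x))"
    by (simp add: cinner_complex_def cmod_def power2_eq_square)
qed (auto simp: scaleC_complex_def cinner_complex_def algebra_simps scaleR_conv_of_real)

end

definition bounded_clinear :: "('a::complex_inner \<Rightarrow> 'a) \<Rightarrow> bool"
  where "bounded_clinear T \<longleftrightarrow> bounded_linear T \<and> (\<forall>a x. T (a *\<^sub>C x) = a *\<^sub>C T x)"

definition boundedly_invertible :: "('a::complex_inner \<Rightarrow> 'a) \<Rightarrow> bool"
  where "boundedly_invertible D \<longleftrightarrow> (\<exists>S. bounded_clinear S \<and> S \<circ> D = id \<and> D \<circ> S = id)"

definition numerical_range :: "('a::complex_inner \<Rightarrow> 'a) \<Rightarrow> complex set"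
  where "numerical_range T = {cinner (T x) x | x. norm x = 1}"

definition sector :: "real \<Rightarrow> complex set"
  where "sector \<alpha> = {rcis r \<theta> | r \<theta>. 0 \<le> r \<and> \<bar>\<theta>\<bar> \<le> \<alpha>}"

text \<open>
  The operators \<open>(A - I)\<^sup>2 + cnj c (A + I)\<^sup>2\<close> and \<open>(A + I)\<^sup>2 + c (A - I)\<^sup>2\<close>; here \<open>^^\<close> is iteration,
  i.e. the power of an operator.
\<close>

definition num_op :: "complex \<Rightarrow> ('a::complex_inner \<Rightarrow> 'a) \<Rightarrow> 'a \<Rightarrow> 'a"
  where "num_op c A = (\<lambda>x. ((\<lambda>y. A y - y) ^^ 2) x + cnj c *\<^sub>C ((\<lambda>y. A y + y) ^^ 2) x)"

definition den_op :: "complex \<Rightarrow> ('a::complex_inner \<Rightarrow> 'a) \<Rightarrow> 'a \<Rightarrow> 'a"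
  where "den_op c A = (\<lambda>x. ((\<lambda>y. A y + y) ^^ 2) x + c *\<^sub>C ((\<lambda>y. A y - y) ^^ 2) x)"

definition num_fun :: "complex \<Rightarrow> complex \<Rightarrow> complex"
  where "num_fun c z = (z - 1)^2 + cnj c * (z + 1)^2"

definition den_fun :: "complex \<Rightarrow> complex \<Rightarrow> complex"
  where "den_fun c z = (z + 1)^2 + c * (z - 1)^2"

definition blaschke2_on_rhp :: "(complex \<Rightarrow> complex) \<Rightarrow> bool"
  where "blaschke2_on_rhp f \<longleftrightarrow>
    (\<exists>\<omega> \<zeta>\<^sub>1 \<zeta>\<^sub>2. cmod \<omega> = 1 \<and> 0 < Re \<zeta>\<^sub>1 \<and> 0 < Re \<zeta>\<^sub>2 \<and>
      (\<forall>z. 0 < Re z \<longrightarrow> f z = \<omega> * ((z - \<zeta>\<^sub>1) / (z + cnj \<zeta>\<^sub>1)) * ((z - \<zeta>\<^sub>2) / (z + cnj \<zeta>\<^sub>2))))"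

end

theory Submission
  imports Defs
begin

text \<open>
  Put \<open>y = T\<^sup>2 x\<close> and \<open>h = (T\<^sup>4 + 1) x\<close>. The numerator applied to \<open>x\<close> is \<open>(1 + cnj c) h - 2 (1 - cnj c) y\<close> and
  the denominator is \<open>(1 + c) h + 2 (1 - c) y\<close>. The bound \<open>sqrt 2\<close> for all \<open>c\<close> in the unit disc follows
  from a single condition without \<open>c\<close> (\<open>moebius_norm_estimate\<close>): if the inner product \<open>r + i s\<close> of
  \<open>h\<close> and \<open>y\<close> has \<open>r \<le> 0\<close>, then \<open>9 r\<^sup>2 + s\<^sup>2 \<le> \<parallel>h\<parallel>\<^sup>2 \<parallel>y\<parallel>\<^sup>2\<close>.

  Since formally \<open>h = (T\<^sup>2 + T\<^sup>-\<^sup>2) y = (B\<^sup>2 - 2) y\<close> for \<open>B = T + T\<inverse>\<close>, the condition concerns \<open>B\<close>. The map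
  \<open>z + 1 / z\<close> sends the boundary rays of the sector to the hyperbola \<open>x\<^sup>2 - y\<^sup>2 = 2\<close>, and in fact the numerical
  range of \<open>B\<close> lies in the convex region right of this hyperbola. This is an identity that combines the
  two half-plane conditions defining the sector (\<open>hyperbola_form\<close>).

  From here on only this property of \<open>B\<close> is used, scaled such that the hyperbola is \<open>x\<^sup>2 - y\<^sup>2 = 1\<close> and the
  operator of interest is \<open>B\<^sup>2 - 1\<close>. For a unit vector \<open>y\<close> let \<open>B y = \<beta> y + \<omega> e\<close> with \<open>e\<close> a unit vector
  orthogonal to \<open>y\<close>, and let \<open>\<xi>\<close> and \<open>\<mu>\<close> be the components of \<open>B e\<close> along \<open>y\<close> and \<open>e\<close>. Then
  \<open>(B\<^sup>2 - 1) y\<close> has the components \<open>\<beta>\<^sup>2 - 1 + \<omega> \<xi>\<close> and \<open>\<omega> (\<beta> + \<mu>)\<close> along \<open>y\<close> and \<open>e\<close>, and the condition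
  becomes \<open>- 2 sqrt 2 Re (\<beta>\<^sup>2 - 1 + \<omega> \<xi>) \<le> \<omega> |\<beta> + \<mu>|\<close>, a statement about a two-by-two matrix
  (\<open>two_by_two_estimate\<close>). The hypothesis on that matrix is one determinant inequality for every tangent
  of the hyperbola; averaging it over pairs of tangents that are symmetric with respect to \<open>\<beta>\<close> reduces the
  problem to an inequality between four real numbers (\<open>scalar_inequality\<close>).

  The denominator is, up to the factor \<open>1 + c\<close>, a product of operators \<open>T - \<sigma>\<close> with \<open>\<sigma>\<^sup>2\<close> in the left
  half-plane, hence \<open>\<sigma>\<close> outside the sector. Such an operator becomes coercive after multiplication by a
  complex number, and coercive operators are invertible (\<open>coercive_boundedly_invertible\<close>).
\<close>

section \<open>An extremal problem for real numbers\<close>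

text \<open>
  With \<open>(\<sigma>, C)\<close> and \<open>(s, c)\<close> on the unit circle this is a statement about two angles. Equality holds
  at \<open>\<sigma> = C = 1 / sqrt 2\<close> and \<open>s = 1 / 3\<close>. If \<open>C \<ge> 1 / 3\<close>, then \<open>s + 2 sqrt 2 c \<le> 3\<close> by Cauchy-Schwarz, and what is left
  is a polynomial in \<open>C\<close> with a double root at \<open>1 / sqrt 2\<close>. If \<open>C < 1 / 3\<close>, then \<open>\<sigma> \<le> c\<close> keeps \<open>(s, c)\<close> away
  from the maximiser of \<open>s + 2 sqrt 2 c\<close>, so that the extreme position is \<open>(s, c) = (C, \<sigma>)\<close>.
\<close>

lemma trig_bound:
  fixes \<sigma> C s c :: real
  assumes "\<sigma>\<^sup>2 + C\<^sup>2 = 1" "s\<^sup>2 + c\<^sup>2 = 1" "0 \<le> \<sigma>" "0 \<le> C" "\<sigma> \<le> c"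
  shows "\<sigma> * (s + 2 * sqrt 2 * c) \<le> C + 2 * sqrt 2 * \<sigma>\<^sup>2"
proof -
  define r where "r = sqrt (2::real)"
  have r: "r\<^sup>2 = 2" "r > 1" by (auto simp: r_def)
  show ?thesis
  proof (cases "1/3 \<le> C")
    case True
    have "(s + 2 * r * c)\<^sup>2 + (2 * r * s - c)\<^sup>2 = (1 + 4 * r\<^sup>2) * (s\<^sup>2 + c\<^sup>2)"
      by algebra
    then have "(s + 2 * r * c)\<^sup>2 + (2 * r * s - c)\<^sup>2 = 9" unfolding assms(2) r(1) by simp
    moreover have "(s + 2 * r * c)\<^sup>2 \<le> (s + 2 * r * c)\<^sup>2 + (2 * r * s - c)\<^sup>2" by simp
    ultimately have "(s + 2 * r * c)\<^sup>2 \<le> 3\<^sup>2" by (simp only:) simp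
    then have "s + 2 * r * c \<le> 3" by (rule power2_le_imp_le) simp
    then have 1: "\<sigma> * (s + 2 * r * c) \<le> \<sigma> * 3" using assms(3) by (rule mult_left_mono)
    have eq: "(C + 2 * r * \<sigma>\<^sup>2)\<^sup>2 - (3 * \<sigma>)\<^sup>2 = (r * C - 1)\<^sup>2 * (4 * C\<^sup>2 + 2 * r * C - 1)"
    proof -
      have s2: "\<sigma>\<^sup>2 = 1 - C\<^sup>2" using assms(1) by simp
      show ?thesis using s2 r(1) by algebra
    qed
    have "(1/3) * (1/3) \<le> C * C" using True by (intro mult_mono) auto
    moreover have "1 * (1/3) \<le> r * C" using True r by (intro mult_mono) auto
    moreover have "4 * C\<^sup>2 + 2 * r * C - 1 \<ge> 0"
      using calculation by (simp add: power2_eq_square)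
    ultimately have "(3 * \<sigma>)\<^sup>2 \<le> (C + 2 * r * \<sigma>\<^sup>2)\<^sup>2" using eq by (smt (verit) mult_nonneg_nonneg zero_le_power2)
    then have "3 * \<sigma> \<le> C + 2 * r * \<sigma>\<^sup>2"
      by (rule power2_le_imp_le) (use True r in auto)
    then show ?thesis using 1 unfolding r_def by simp
  next
    case False
    have \<sigma>9: "8 \<le> 9 * \<sigma>\<^sup>2"
    proof -
      have "C\<^sup>2 \<le> (1/3)\<^sup>2" using False assms by (intro power_mono) auto
      then show ?thesis using assms(1) by (simp add: power2_eq_square)
    qed
    have cC: "2 * r * C \<le> \<sigma>"
    proof (rule power2_le_imp_le)
      have "C\<^sup>2 * 9 \<le> 1" using \<sigma>9 assms(1) by simp
      then show "(2 * r * C)\<^sup>2 \<le> \<sigma>\<^sup>2" using r \<sigma>9 by (simp add: power_mult_distrib)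
    qed (use assms in auto)
    have "\<sigma>\<^sup>2 \<le> c\<^sup>2" using assms by (intro power_mono) auto
    then have "s\<^sup>2 \<le> C\<^sup>2" using assms(1,2) by linarith
    then have "s \<le> C" using assms(4) by (rule power2_le_imp_le)
    have "2 * r * s \<le> 2 * r * C" using \<open>s \<le> C\<close> r by simp
    then have k: "2 * r * (C + s) \<le> c + \<sigma>" using cC assms by (simp add: algebra_simps)
    have "2 * r * (c - \<sigma>) \<le> C - s"
    proof (cases "c + \<sigma> = 0")
      case True
      then have "\<sigma> = 0" using assms by linarith
      then show ?thesis using \<sigma>9 by simp
    next
      case False
      then have pos: "c + \<sigma> > 0" using assms by auto
      have "2 * r * (c - \<sigma>) * (c + \<sigma>) = 2 * r * (C + s) * (C - s)"
        using assms(1,2) by algebra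
      also have "\<dots> \<le> (c + \<sigma>) * (C - s)"
        using k \<open>s \<le> C\<close> by (intro mult_right_mono) auto
      finally show ?thesis using pos by (simp add: mult.commute)
    qed
    then have "\<sigma> * (s + 2 * r * c) \<le> \<sigma> * (C + 2 * r * \<sigma>)"
      using assms(3) by (intro mult_left_mono) (auto simp: algebra_simps)
    also have "\<dots> \<le> C + 2 * r * \<sigma>\<^sup>2"
    proof -
      have "\<sigma>\<^sup>2 \<le> 1\<^sup>2" using assms(1) by (smt (verit) zero_le_power2 one_power2)
      then have "\<sigma> \<le> 1" by (rule power2_le_imp_le) simp
      then have "\<sigma> * C \<le> 1 * C" using assms by (intro mult_right_mono) auto
      then show ?thesis by (simp add: power2_eq_square algebra_simps)
    qed
    finally show ?thesis unfolding r_def .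
  qed
qed

text \<open>
  Only the term with \<open>\<alpha>\<close> can make the sum negative. The substitution
  \<open>E = Q \<theta> s\<close>, \<open>\<alpha> = - Q \<theta> c\<close>, \<open>\<theta> = \<sigma> W\<close>, \<open>1 = C W\<close> turns the two quadratic constraints into points of the
  unit circle, and after the estimate \<open>2 n Q \<le> n\<^sup>2 + Q\<^sup>2\<close> only \<open>trig_bound\<close> remains.
\<close>

lemma extremal_inequality:
  fixes Q E \<theta> \<alpha> n W :: real
  assumes "n\<^sup>2 = 1 + Q\<^sup>2" "0 < n" "0 < Q" "W\<^sup>2 = 1 + \<theta>\<^sup>2" "0 < W" "0 \<le> \<theta>"
    and "E\<^sup>2 + \<alpha>\<^sup>2 = Q\<^sup>2 * \<theta>\<^sup>2" "E < Q"
  shows "0 \<le> sqrt 2 * ((n\<^sup>2 + Q\<^sup>2) * \<theta>\<^sup>2 + 2 * n * W * \<alpha>) + (Q - E) * n * W"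
proof (cases "(n\<^sup>2 + Q\<^sup>2) * \<theta>\<^sup>2 + 2 * n * W * \<alpha> \<ge> 0")
  case True
  then show ?thesis using assms by simp
next
  case False
  then have neg: "(n\<^sup>2 + Q\<^sup>2) * \<theta>\<^sup>2 + 2 * n * W * \<alpha> < 0" by simp
  have \<theta>: "\<theta> > 0"
  proof (rule ccontr)
    assume "\<not> \<theta> > 0"
    then have "\<theta> = 0" using assms by simp
    then have "\<alpha> = 0" using assms(7) by (simp add: sum_power2_eq_zero_iff)
    then show False using neg \<open>\<theta> = 0\<close> by simp
  qed
  define s where "s = E / (Q * \<theta>)"
  define c where "c = - \<alpha> / (Q * \<theta>)"
  define \<sigma> where "\<sigma> = \<theta> / W"
  define C where "C = 1 / W"
  have E: "E = Q * \<theta> * s" and \<alpha>: "\<alpha> = - (Q * \<theta> * c)" and \<sigma>: "\<theta> = \<sigma> * W" and C: "1 = C * W"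
    using \<theta> assms by (simp_all add: s_def c_def \<sigma>_def C_def)
  have sc: "s\<^sup>2 + c\<^sup>2 = 1"
  proof -
    have "(Q * \<theta>)\<^sup>2 * (s\<^sup>2 + c\<^sup>2) = (Q * \<theta>)\<^sup>2 * 1"
      using assms(7) unfolding E \<alpha> by (simp add: power_mult_distrib distrib_left)
    then show ?thesis using \<theta> assms by (subst (asm) mult_cancel_left) simp
  qed
  have \<sigma>C: "\<sigma>\<^sup>2 + C\<^sup>2 = 1"
  proof -
    have "W\<^sup>2 * (\<sigma>\<^sup>2 + C\<^sup>2) = (\<sigma> * W)\<^sup>2 + (C * W)\<^sup>2" by algebra
    also have "\<dots> = W\<^sup>2 * 1" using assms(4) by (simp flip: \<sigma> C)
    finally have "W\<^sup>2 * (\<sigma>\<^sup>2 + C\<^sup>2) = W\<^sup>2 * 1" .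
    moreover have "W\<^sup>2 \<noteq> 0" using assms(5) by simp
    ultimately show ?thesis by (metis mult_cancel_left)
  qed
  have amgm: "2 * n * Q \<le> n\<^sup>2 + Q\<^sup>2" using sum_squares_bound[of n Q] by simp
  have nQ: "2 * n * Q * (\<theta>\<^sup>2 - W * \<theta> * c) \<le> (n\<^sup>2 + Q\<^sup>2) * \<theta>\<^sup>2 + 2 * n * W * \<alpha>"
  proof -
    have "2 * n * Q * \<theta>\<^sup>2 \<le> (n\<^sup>2 + Q\<^sup>2) * \<theta>\<^sup>2" using amgm by (rule mult_right_mono) simp
    then show ?thesis unfolding \<alpha> by (simp add: algebra_simps)
  qed
  have "2 * n * Q * (\<theta>\<^sup>2 - W * \<theta> * c) < 0" using nQ neg by linarith
  then have "\<theta>\<^sup>2 - W * \<theta> * c < 0" using assms(2,3) by (simp add: mult_less_0_iff)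
  then have "\<theta> * \<theta> < \<theta> * (W * c)" by (simp add: power2_eq_square algebra_simps)
  then have "\<theta> < W * c" using \<theta> by simp
  then have "\<sigma> \<le> c" unfolding \<sigma>_def using assms by (simp add: field_simps)
  then have tr: "\<sigma> * (s + 2 * sqrt 2 * c) \<le> C + 2 * sqrt 2 * \<sigma>\<^sup>2"
    using assms \<theta> by (intro trig_bound \<sigma>C sc) (auto simp: \<sigma>_def C_def)
  have "0 \<le> n * Q * W\<^sup>2 * (C + 2 * sqrt 2 * \<sigma>\<^sup>2 - \<sigma> * (s + 2 * sqrt 2 * c))"
    using tr assms by simp
  also have "\<dots> = sqrt 2 * (2 * n * Q * ((\<sigma> * W)\<^sup>2 - W * (\<sigma> * W) * c)) + (Q * (C * W) - Q * (\<sigma> * W) * s) * n * W"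
    by (simp add: power2_eq_square algebra_simps)
  also have "\<dots> = sqrt 2 * (2 * n * Q * (\<theta>\<^sup>2 - W * \<theta> * c)) + (Q - E) * n * W"
    unfolding E by (simp flip: \<sigma> C)
  also have "\<dots> \<le> sqrt 2 * ((n\<^sup>2 + Q\<^sup>2) * \<theta>\<^sup>2 + 2 * n * W * \<alpha>) + (Q - E) * n * W"
    using nQ by simp
  finally show ?thesis .
qed

text \<open>
  The hypothesis is a family of lower bounds for \<open>p\<close>, of which one has to choose the best one, so
  \<open>w\<close> should maximise \<open>w + (E\<^sup>2 + (1 - w\<^sup>2) Q\<^sup>2) / (a - w)\<close>, where \<open>Q = (D + d) / 2\<close> and \<open>E = (d - D) / 2\<close>. With
  \<open>\<nu> = a - w\<close> this is a constant minus \<open>(1 + Q\<^sup>2) \<nu> + (Q\<^sup>2 (a\<^sup>2 - 1) - E\<^sup>2) / \<nu>\<close>. If the maximiser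
  has \<open>w \<le> 1\<close>, then the bound simplifies to \<open>a + p \<ge> 2 (1 + Q\<^sup>2) w\<close>, and the claim is
  \<open>extremal_inequality\<close>. Otherwise \<open>w = 1\<close> is good enough, except that for \<open>a = 1\<close> it only yields
  \<open>E = 0\<close>, and \<open>w = 1 / 2\<close> gives the rest.
\<close>

lemma scalar_inequality:
  fixes a p D d :: real
  assumes a: "1 \<le> a" and D: "0 < D"
    and H: "\<And>w. 0 < w \<Longrightarrow> w \<le> 1 \<Longrightarrow>
      (D\<^sup>2 + d\<^sup>2) / 2 - w\<^sup>2 * (D + d)\<^sup>2 / 4 \<le> (p - w) * (a - w)"
  shows "2 * sqrt 2 * (D * d + 1 - a\<^sup>2) \<le> D * (a + p)"
proof -
  define r where "r = sqrt (2::real)"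
  have r: "r\<^sup>2 = 2" "r > 1" "r * r = 2" by (auto simp: r_def)
  define Q where "Q = (D + d) / 2"
  define E where "E = (d - D) / 2"
  have DQ: "D = Q - E" "d = Q + E" by (auto simp: Q_def E_def field_simps)
  have H': "E\<^sup>2 + (1 - w\<^sup>2) * Q\<^sup>2 \<le> (p - w) * (a - w)" if "0 < w" "w \<le> 1" for w
  proof -
    have "(D\<^sup>2 + d\<^sup>2) / 2 - w\<^sup>2 * (D + d)\<^sup>2 / 4 = E\<^sup>2 + (1 - w\<^sup>2) * Q\<^sup>2"
      by (simp add: DQ power2_eq_square field_simps)
    then show ?thesis using H[OF that] by simp
  qed
  have p: "0 < p"
  proof -
    have "0 \<le> E\<^sup>2 + (1 - (1/2)\<^sup>2) * Q\<^sup>2" by (simp add: power2_eq_square)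
    then have "0 \<le> (p - 1/2) * (a - 1/2)" using H'[of "1/2"] by simp
    then show ?thesis using a by (simp add: zero_le_mult_iff)
  qed
  show ?thesis
  proof (cases "D * d + 1 - a\<^sup>2 \<le> 0")
    case True
    then have "2 * sqrt 2 * (D * d + 1 - a\<^sup>2) \<le> 0" by (simp add: mult_nonneg_nonpos)
    also have "0 \<le> D * (a + p)" using a D p by simp
    finally show ?thesis .
  next
    case False
    have a2: "1 \<le> a\<^sup>2" using a by simp
    then have "D * d > 0" using False by linarith
    then have d: "d > 0" using D by (simp add: zero_less_mult_iff)
    have Q: "Q > 0" "E < Q" "- E < Q" using D d by (auto simp: Q_def E_def field_simps)
    define N where "N = 1 + Q\<^sup>2"
    have N: "N > 0" unfolding N_def by (smt (verit) zero_le_power2)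
    have goalE: "D * d = Q\<^sup>2 - E\<^sup>2" by (simp add: DQ power2_eq_square algebra_simps)
    consider (one) "a = 1" | (cap) "1 < a" "Q\<^sup>2 * (a\<^sup>2 - 1) - E\<^sup>2 \<le> N * (a - 1)\<^sup>2"
      | (int) "1 < a" "N * (a - 1)\<^sup>2 < Q\<^sup>2 * (a\<^sup>2 - 1) - E\<^sup>2"
      using a by linarith
    then show ?thesis
    proof cases
      case one
      have "E\<^sup>2 \<le> 0" using H'[of 1] one by simp
      then have E: "E = 0" by simp
      have "(1 - (1/2)\<^sup>2) * Q\<^sup>2 \<le> (p - 1/2) * (1/2)" using H'[of "1/2"] one E by simp
      then have "1 / 2 + 3 / 2 * Q\<^sup>2 \<le> p" by (simp add: power2_eq_square)
      moreover have "2 * r * Q \<le> 3 / 2 + 3 / 2 * Q\<^sup>2"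
      proof -
        have "2 * (3 / 2) * Q \<le> 3 / 2 + 3 / 2 * Q\<^sup>2"
          using zero_le_power2[of "Q - 1"] by (simp add: power2_eq_square algebra_simps)
        moreover have "r \<le> 3 / 2" unfolding r_def by (rule real_le_lsqrt) (simp_all add: power2_eq_square)
        then have "2 * r * Q \<le> 2 * (3 / 2) * Q" using Q by simp
        ultimately show ?thesis by linarith
      qed
      ultimately have "2 * r * Q \<le> 1 + p" by linarith
      then have "Q * (2 * r * Q) \<le> Q * (1 + p)" using Q by (intro mult_left_mono) auto
      then show ?thesis unfolding r_def[symmetric] one goalE E DQ
        by (simp add: power2_eq_square algebra_simps)
    next
      case cap
      define h where "h = a - 1"
      have h: "h > 0" "a = 1 + h" using cap by (auto simp: h_def)
      define X where "X = E\<^sup>2 / h"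
      have X: "E\<^sup>2 = h * X" using h by (simp add: X_def)
      have pX: "1 + X \<le> p"
      proof -
        have "h * X \<le> (p - 1) * h" using H'[of 1] X h by simp
        then have "h * X \<le> h * (p - 1)" by (simp only: mult.commute)
        then show ?thesis using h by simp
      qed
      have capX: "2 * Q\<^sup>2 - h \<le> X"
      proof -
        have "h * (2 * Q\<^sup>2 - h) \<le> h * X"
          using cap(2) unfolding X h(2) N_def by (simp add: power2_eq_square algebra_simps)
        then show ?thesis using h by simp
      qed
      \<comment> \<open>For large \<open>D\<close> the bound \<open>capX\<close> makes the bracket nonnegative. For small \<open>D\<close> the last summand
        compensates, and \<open>X - 4 r E\<close> may be minimised over \<open>E\<close>.\<close>
      have key: "0 \<le> D * (2 + h + X - 2 * r * (Q + E)) + 2 * r * (h\<^sup>2 + 2 * h)"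
      proof (cases "1 \<le> r * D")
        case True
        have "2 + h + X - 2 * r * (Q + E) \<ge> 2 + 2 * Q\<^sup>2 - 2 * r * (2 * Q - D)"
          using capX by (simp add: DQ)
        also have "2 + 2 * Q\<^sup>2 - 2 * r * (2 * Q - D) = 2 * (Q - r)\<^sup>2 + 2 * (r * D - 1)"
          using r(3) by (simp add: power2_eq_square algebra_simps)
        finally have "2 * (Q - r)\<^sup>2 + 2 * (r * D - 1) \<le> 2 + h + X - 2 * r * (Q + E)" .
        moreover have "0 \<le> 2 * (Q - r)\<^sup>2 + 2 * (r * D - 1)" using True by simp
        ultimately have "2 + h + X - 2 * r * (Q + E) \<ge> 0" by (rule order_trans[rotated])
        then show ?thesis using D h r by (intro add_nonneg_nonneg mult_nonneg_nonneg) auto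
      next
        case False
        have "(E - 2 * r * h)\<^sup>2 = h * (X - 4 * r * E + 4 * r\<^sup>2 * h)"
          unfolding power2_diff X by (simp add: power2_eq_square algebra_simps)
        then have "h * (X - 4 * r * E + 8 * h) = (E - 2 * r * h)\<^sup>2"
          unfolding r(1) by simp
        then have "0 \<le> h * (X - 4 * r * E + 8 * h)" by simp
        then have *: "X - 4 * r * E \<ge> - 8 * h" using h by (simp add: zero_le_mult_iff)
        have D1: "7 * D \<le> 4 * r"
        proof -
          have "r * (7 * D) \<le> 8" using False by simp
          moreover have "r * (4 * r) = 8" using r by simp
          ultimately have "r * (7 * D) \<le> r * (4 * r)" by linarith
          then show ?thesis using r by simp
        qed
        have "2 + h + X - 2 * r * (Q + E) = 2 + h + (X - 4 * r * E) - 2 * r * D"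
          by (simp add: DQ algebra_simps)
        then have "2 + h + X - 2 * r * (Q + E) \<ge> - 7 * h" using * False by linarith
        then have "D * (2 + h + X - 2 * r * (Q + E)) \<ge> D * (- 7 * h)"
          using D by (intro mult_left_mono) auto
        moreover have "D * (- 7 * h) + 4 * r * h \<ge> 0"
        proof -
          have "0 \<le> h * (4 * r - 7 * D)" using D1 h by simp
          then show ?thesis by (simp add: algebra_simps)
        qed
        moreover have "0 \<le> 2 * r * h\<^sup>2" using r by simp
        ultimately show ?thesis by (simp add: algebra_simps)
      qed
      have "2 * r * (D * d + 1 - a\<^sup>2) \<le> D * (2 + h + X)"
        using key unfolding h(2) DQ by (simp add: power2_eq_square algebra_simps)
      also have "\<dots> \<le> D * (a + p)" using pX D h by (intro mult_left_mono) auto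
      finally show ?thesis unfolding r_def .
    next
      case int
      define \<nu> where "\<nu> = sqrt ((Q\<^sup>2 * (a\<^sup>2 - 1) - E\<^sup>2) / N)"
      have rad: "0 \<le> (Q\<^sup>2 * (a\<^sup>2 - 1) - E\<^sup>2) / N"
      proof -
        have "0 \<le> N * (a - 1)\<^sup>2" using N by simp
        then show ?thesis using int(2) N by (intro divide_nonneg_pos) linarith+
      qed
      then have \<nu>0: "0 \<le> \<nu>" unfolding \<nu>_def by (rule real_sqrt_ge_zero)
      have "\<nu>\<^sup>2 = (Q\<^sup>2 * (a\<^sup>2 - 1) - E\<^sup>2) / N" unfolding \<nu>_def using rad by (rule real_sqrt_pow2)
      then have \<nu>2: "N * \<nu>\<^sup>2 = Q\<^sup>2 * (a\<^sup>2 - 1) - E\<^sup>2" using N by (simp only: times_divide_eq_right nonzero_mult_div_cancel_left less_imp_neq[symmetric] not_False_eq_True simp_thms if_True)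
      have \<nu>1: "a - 1 < \<nu>"
      proof -
        have "N * (a - 1)\<^sup>2 < N * \<nu>\<^sup>2" unfolding \<nu>2 by (rule int(2))
        then have "(a - 1)\<^sup>2 < \<nu>\<^sup>2" using N by (simp only: mult_less_cancel_left_pos)
        then show ?thesis using \<nu>0 by (rule power2_less_imp_less)
      qed
      have \<nu>a: "\<nu> < a"
      proof -
        have "N * \<nu>\<^sup>2 < N * a\<^sup>2"
        proof -
          have "N * a\<^sup>2 = a\<^sup>2 + Q\<^sup>2 * a\<^sup>2" by (simp add: N_def distrib_right)
          moreover have "N * \<nu>\<^sup>2 = Q\<^sup>2 * a\<^sup>2 - Q\<^sup>2 - E\<^sup>2" unfolding \<nu>2 by (simp add: right_diff_distrib)
          ultimately show ?thesis using a2 zero_le_power2[of E] zero_le_power2[of Q] by linarith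
        qed
        then have "\<nu>\<^sup>2 < a\<^sup>2" using N by (simp only: mult_less_cancel_left_pos)
        then show ?thesis using a by (rule power2_less_imp_less[OF _ order_trans[OF zero_le_one]])
      qed
      define w where "w = a - \<nu>"
      have w: "0 < w" "w \<le> 1" "a = w + \<nu>" using \<nu>1 \<nu>a unfolding w_def by linarith+
      have \<nu>: "\<nu> > 0" using \<nu>1 int(1) by linarith
      have E2: "E\<^sup>2 = Q\<^sup>2 * ((w + \<nu>)\<^sup>2 - 1) - (1 + Q\<^sup>2) * \<nu>\<^sup>2"
        using \<nu>2 unfolding w(3) N_def by linarith
      have "\<nu> * (2 * N * w - w - a) = E\<^sup>2 + (1 - w\<^sup>2) * Q\<^sup>2"
        unfolding E2 N_def w(3) by (simp add: power2_eq_square algebra_simps)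
      moreover have "E\<^sup>2 + (1 - w\<^sup>2) * Q\<^sup>2 \<le> (p - w) * \<nu>"
        using H'[OF w(1,2)] unfolding w_def by simp
      ultimately have "\<nu> * (2 * N * w - w - a) \<le> \<nu> * (p - w)" by (simp only: mult.commute)
      then have "2 * N * w - w - a \<le> p - w" using \<nu> by (simp only: mult_le_cancel_left_pos)
      then have ap: "2 * N * w \<le> a + p" by linarith
      define n where "n = sqrt N"
      define \<theta> where "\<theta> = sqrt (N * w\<^sup>2 - 1)"
      \<comment> \<open>With the optimal \<open>w\<close> the point \<open>(E, \<alpha>)\<close> lies on the circle of radius \<open>Q \<theta>\<close>.\<close>
      define \<alpha> where "\<alpha> = a - N * w"
      have n: "n\<^sup>2 = 1 + Q\<^sup>2" "0 < n" using N by (auto simp: n_def N_def)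
      have e: "E\<^sup>2 + \<alpha>\<^sup>2 = Q\<^sup>2 * (N * w\<^sup>2 - 1)"
        unfolding E2 \<alpha>_def N_def w(3) by (simp add: power2_eq_square algebra_simps)
      have "0 \<le> Q\<^sup>2 * (N * w\<^sup>2 - 1)" unfolding e[symmetric] by simp
      then have "0 \<le> N * w\<^sup>2 - 1" using zero_less_power[OF Q(1), of 2] by (smt (verit) mult_pos_neg)
      then have \<theta>: "\<theta>\<^sup>2 = N * w\<^sup>2 - 1" "0 \<le> \<theta>"
        unfolding \<theta>_def by (rule real_sqrt_pow2, rule real_sqrt_ge_zero)
      have nonneg: "0 \<le> sqrt 2 * ((n\<^sup>2 + Q\<^sup>2) * \<theta>\<^sup>2 + 2 * n * (n * w) * \<alpha>) + (Q - E) * n * (n * w)"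
      proof (rule extremal_inequality[OF n(1) n(2) Q(1) _ _ \<theta>(2) _ Q(2)])
        show "(n * w)\<^sup>2 = 1 + \<theta>\<^sup>2" unfolding power_mult_distrib n(1) \<theta>(1) N_def by simp
        show "0 < n * w" using n w(1) by simp
        show "E\<^sup>2 + \<alpha>\<^sup>2 = Q\<^sup>2 * \<theta>\<^sup>2" unfolding e \<theta>(1) ..
      qed
      have "0 \<le> r * (a\<^sup>2 - 1 - D * d) + D * (N * w)"
      proof -
        have "(n\<^sup>2 + Q\<^sup>2) * \<theta>\<^sup>2 + 2 * n * (n * w) * \<alpha> = (n\<^sup>2 + Q\<^sup>2) * \<theta>\<^sup>2 + 2 * n\<^sup>2 * w * \<alpha>"
          by (simp add: power2_eq_square)
        also have "\<dots> = a\<^sup>2 - 1 - D * d"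
          unfolding n(1) \<theta>(1) \<alpha>_def goalE E2 N_def w(3) by (simp add: power2_eq_square algebra_simps)
        finally have 1: "(n\<^sup>2 + Q\<^sup>2) * \<theta>\<^sup>2 + 2 * n * (n * w) * \<alpha> = a\<^sup>2 - 1 - D * d" .
        have 2: "(Q - E) * n * (n * w) = D * (N * w)"
          unfolding N_def n(1)[symmetric] DQ by (simp add: power2_eq_square)
        show ?thesis using nonneg unfolding 1 2 r_def .
      qed
      then have "r * (D * d + 1 - a\<^sup>2) \<le> D * (N * w)" by (simp add: right_diff_distrib distrib_left)
      then have "2 * r * (D * d + 1 - a\<^sup>2) \<le> D * (2 * N * w)" by simp
      moreover have "D * (2 * N * w) \<le> D * (a + p)" using ap D by (intro mult_left_mono) auto
      ultimately show ?thesis unfolding r_def by (rule order_trans)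
    qed
  qed
qed

section \<open>Two-by-two matrices with numerical range right of a hyperbola\<close>

text \<open>
  The point \<open>cosh t + \<i> sinh t\<close> for \<open>u = e\<^sup>t\<close>. The half-planes \<open>Re (hyp_dir u * z) \<ge> 1\<close> are those bounded by the
  tangents of the hyperbola branch \<open>x\<^sup>2 - y\<^sup>2 = 1\<close>, \<open>x > 0\<close>. The parameter \<open>u\<close> instead of \<open>t\<close> keeps
  everything rational.
\<close>

definition hyp_dir :: "real \<Rightarrow> complex"
  where "hyp_dir u = Complex ((u + 1 / u) / 2) ((u - 1 / u) / 2)"

lemma Re_hyp_dir_mult:
  "Re (hyp_dir u * z) = (u * (Re z - Im z) + (Re z + Im z) / u) / 2"
  by (simp add: hyp_dir_def field_simps) (simp add: add_divide_distrib)

lemma cmod_hyp_dir_combination: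
  assumes "u > 0"
  shows "(cmod (cnj (hyp_dir u) * complex_of_real \<omega> + hyp_dir u * \<xi>))\<^sup>2
    = (u\<^sup>2 + 1 / u\<^sup>2) / 2 * (\<omega>\<^sup>2 + (Re \<xi>)\<^sup>2 + (Im \<xi>)\<^sup>2) + 2 * \<omega> * Re \<xi> - \<omega> * (u\<^sup>2 - 1 / u\<^sup>2) * Im \<xi>"
proof -
  have 1: "(cmod (cnj (Complex A B) * complex_of_real \<omega> + Complex A B * \<xi>))\<^sup>2
      = (A\<^sup>2 + B\<^sup>2) * (\<omega>\<^sup>2 + (Re \<xi>)\<^sup>2 + (Im \<xi>)\<^sup>2) + 2 * \<omega> * ((A\<^sup>2 - B\<^sup>2) * Re \<xi> - 2 * (A * B) * Im \<xi>)" for A B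
    unfolding cmod_power2 by (simp add: power2_eq_square algebra_simps)
  have 2: "((u + 1 / u) / 2)\<^sup>2 + ((u - 1 / u) / 2)\<^sup>2 = (u\<^sup>2 + 1 / u\<^sup>2) / 2"
    "((u + 1 / u) / 2)\<^sup>2 - ((u - 1 / u) / 2)\<^sup>2 = 1"
    "2 * ((u + 1 / u) / 2 * ((u - 1 / u) / 2)) = (u\<^sup>2 - 1 / u\<^sup>2) / 2"
    using assms by (simp_all add: field_simps power2_eq_square)
  show ?thesis unfolding hyp_dir_def 1 2 by (simp add: right_diff_distrib)
qed

text \<open>
  A point right of all tangents lies on a hyperbola \<open>x\<^sup>2 - y\<^sup>2 = a\<^sup>2\<close> with \<open>a \<ge> 1\<close>; the number \<open>s\<close> is the
  exponential of its hyperbolic angle. The tangent whose \<open>u\<close> is that same \<open>s\<close> shows \<open>a \<ge> 1\<close>.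
\<close>

lemma hyperbola_coordinates:
  assumes "\<And>u. u > 0 \<Longrightarrow> 1 \<le> Re (hyp_dir u * \<beta>)"
  obtains a s where "1 \<le> a" "0 < s" "Re \<beta> - Im \<beta> = a / s" "Re \<beta> + Im \<beta> = a * s" "Re (\<beta>\<^sup>2) = a\<^sup>2"
proof -
  define P where "P = Re \<beta> - Im \<beta>"
  define R where "R = Re \<beta> + Im \<beta>"
  have H: "2 \<le> u * P + R / u" if "u > 0" for u
    using assms[OF that] unfolding Re_hyp_dir_mult P_def R_def by simp
  have P: "P > 0"
  proof (rule ccontr)
    assume "\<not> P > 0"
    then have "(1 + \<bar>R\<bar>) * P \<le> 0" by (simp add: mult_nonneg_nonpos)
    moreover have "R / (1 + \<bar>R\<bar>) < 1"
      using divide_strict_right_mono[of R "1 + \<bar>R\<bar>" "1 + \<bar>R\<bar>"] by (simp add: abs_if split: if_splits)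
    moreover have "2 \<le> (1 + \<bar>R\<bar>) * P + R / (1 + \<bar>R\<bar>)" by (rule H) (simp add: add_pos_nonneg)
    ultimately show False by linarith
  qed
  have R: "R > 0"
  proof (rule ccontr)
    assume "\<not> R > 0"
    then have "R / (1 / (1 + P)) \<le> 0" using P by (simp add: mult_nonpos_nonneg)
    moreover have "1 / (1 + P) * P < 1" using P by (simp add: divide_less_eq)
    moreover have "2 \<le> 1 / (1 + P) * P + R / (1 / (1 + P))" using P by (intro H) simp
    ultimately show False by linarith
  qed
  define a where "a = sqrt P * sqrt R"
  define s where "s = sqrt R / sqrt P"
  have s: "s > 0" "P = a / s" "R = a * s" using P R by (simp_all add: a_def s_def)
  have a: "a * a = P * R"
  proof -
    have "a * a = (sqrt P * sqrt P) * (sqrt R * sqrt R)" by (simp only: a_def mult_ac)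
    then show ?thesis using P R by simp
  qed
  have "2 \<le> s * P + R / s" using s(1) by (rule H)
  then have "1 \<le> a" using s by simp
  moreover have "Re (\<beta>\<^sup>2) = a\<^sup>2"
    unfolding power2_eq_square a P_def R_def by (simp add: algebra_simps)
  ultimately show ?thesis using that s unfolding P_def R_def by blast
qed

text \<open>
  This is the heart of the proof, a statement about the matrix \<open>B\<close> with rows \<open>(\<beta>, \<xi>)\<close> and
  \<open>(\<omega>, \<mu>)\<close>: the hypotheses say that its numerical range lies right of every tangent of the hyperbola
  (a determinant condition on the Hermitian part of \<open>hyp_dir u B - 1\<close>), and the conclusion compares the two
  entries of the first column of \<open>B\<^sup>2 - 1\<close>.

  It is enough to average the determinant condition over the two directions \<open>u = s k\<close> and \<open>u = s / k\<close>
  that are symmetric about the hyperbolic angle of \<open>\<beta>\<close>; they have the same value \<open>Re (hyp_dir u \<beta>) = a / w\<close>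
  with \<open>w = 2 / (k + 1 / k)\<close>. The imaginary part of \<open>\<xi>\<close> can be removed by completing a square, and the
  position of \<open>\<beta>\<close> on its hyperbola enters only through \<open>\<kappa>\<close>, which rescales \<open>\<omega>\<close> and \<open>Re \<xi>\<close>. What remains is
  \<open>scalar_inequality\<close>.
\<close>

lemma two_by_two_estimate:
  fixes \<beta> \<xi> \<mu> :: complex and \<omega> :: real
  assumes \<omega>: "\<omega> > 0"
    and \<beta>: "\<And>u. u > 0 \<Longrightarrow> 1 \<le> Re (hyp_dir u * \<beta>)"
    and det: "\<And>u. u > 0 \<Longrightarrow> (cmod (cnj (hyp_dir u) * complex_of_real \<omega> + hyp_dir u * \<xi>))\<^sup>2
                \<le> 4 * (Re (hyp_dir u * \<beta>) - 1) * (Re (hyp_dir u * \<mu>) - 1)"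
  shows "2 * sqrt 2 * (1 - Re (\<beta>\<^sup>2 + complex_of_real \<omega> * \<xi>)) \<le> \<omega> * cmod (\<beta> + \<mu>)"
proof -
  obtain a s where a: "1 \<le> a" and s: "0 < s" and P: "Re \<beta> - Im \<beta> = a / s"
    and R: "Re \<beta> + Im \<beta> = a * s" and a2: "Re (\<beta>\<^sup>2) = a\<^sup>2"
    using hyperbola_coordinates[OF \<beta>] by metis
  define \<alpha> where "\<alpha> = s * (Re \<mu> - Im \<mu>)"
  define \<alpha>' where "\<alpha>' = (Re \<mu> + Im \<mu>) / s"
  define p where "p = (\<alpha> + \<alpha>') / 2"
  define S where "S = s\<^sup>2"
  \<comment> \<open>If \<open>s = e\<^sup>\<tau>\<close>, then \<open>\<kappa> = cosh (2 \<tau>)\<close> and \<open>\<eta> = sinh (2 \<tau>)\<close>.\<close>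
  define \<kappa> where "\<kappa> = (S + 1 / S) / 2"
  define \<eta> where "\<eta> = (S - 1 / S) / 2"
  define x1 where "x1 = Re \<xi>"
  define x2 where "x2 = Im \<xi>"
  have S: "S > 0" using s by (simp add: S_def)
  have \<kappa>: "\<kappa> > 0" using S by (simp add: \<kappa>_def add_pos_pos)
  have \<kappa>\<eta>: "\<kappa>\<^sup>2 - \<eta>\<^sup>2 = 1" using S by (simp add: \<kappa>_def \<eta>_def power2_eq_square field_simps)
  define D where "D = \<omega> / sqrt \<kappa>"
  define d where "d = - (sqrt \<kappa> * x1)"
  have D: "D > 0" using \<omega> \<kappa> by (simp add: D_def)
  have D2: "D\<^sup>2 = \<omega>\<^sup>2 / \<kappa>" and d2: "d\<^sup>2 = \<kappa> * x1\<^sup>2" and Dd: "D * d = - (\<omega> * x1)"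
    using \<kappa> by (simp_all add: D_def d_def power_divide power_mult_distrib)
  have "2 * sqrt 2 * (D * d + 1 - a\<^sup>2) \<le> D * (a + p)"
  proof (rule scalar_inequality[OF a D])
    fix w :: real
    assume w: "0 < w" "w \<le> 1"
    \<comment> \<open>The larger solution of \<open>k + 1 / k = 2 / w\<close>.\<close>
    define k where "k = (1 + sqrt (1 - w\<^sup>2)) / w"
    have w1: "w\<^sup>2 \<le> 1" using w by (simp add: power_le_one)
    have k: "k > 0" using w w1 by (simp add: k_def add_pos_nonneg)
    have kw: "k + 1 / k = 2 / w"
    proof -
      have "(w * k - 1)\<^sup>2 = 1 - w\<^sup>2" using w w1 by (simp add: k_def)
      then have "w * (w * (k * k) - 2 * k + w) = 0" by (simp add: power2_eq_square algebra_simps)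
      then have "w * (k * k) - 2 * k + w = 0" using w by simp
      then show ?thesis using w k by (simp add: field_simps)
    qed
    define K where "K = k\<^sup>2 + 1 / k\<^sup>2"
    have K: "K = 4 / w\<^sup>2 - 2"
    proof -
      have "(k + 1 / k)\<^sup>2 = K + 2" using k by (simp add: K_def power2_eq_square field_simps)
      then show ?thesis unfolding kw by (simp add: power_divide)
    qed
    have K0: "K > 0" using k by (simp add: K_def add_pos_pos)
    have b1: "Re (hyp_dir (s * k) * \<beta>) = a / w"
      and b2: "Re (hyp_dir (s / k) * \<beta>) = a / w"
    proof -
      have "Re (hyp_dir (s * k) * \<beta>) = a * (k + 1 / k) / 2"
        and "Re (hyp_dir (s / k) * \<beta>) = a * (k + 1 / k) / 2"
        unfolding Re_hyp_dir_mult P R using s k by (simp_all add: field_simps)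
      then show "Re (hyp_dir (s * k) * \<beta>) = a / w" "Re (hyp_dir (s / k) * \<beta>) = a / w"
        unfolding kw by simp_all
    qed
    have m: "Re (hyp_dir (s * k) * \<mu>) + Re (hyp_dir (s / k) * \<mu>) = 2 * p / w"
    proof -
      have "Re (hyp_dir (s * k) * \<mu>) + Re (hyp_dir (s / k) * \<mu>) = p * (k + 1 / k)"
        unfolding Re_hyp_dir_mult p_def \<alpha>_def \<alpha>'_def using s k by (simp add: field_simps)
      then show ?thesis unfolding kw by simp
    qed
    have sk: "s * k > 0" "s / k > 0" using s k by simp_all
    have "\<kappa> * K * (\<omega>\<^sup>2 + x1\<^sup>2 + x2\<^sup>2) + 4 * \<omega> * x1 - 2 * \<omega> * \<eta> * K * x2
       = (cmod (cnj (hyp_dir (s * k)) * complex_of_real \<omega> + hyp_dir (s * k) * \<xi>))\<^sup>2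
       + (cmod (cnj (hyp_dir (s / k)) * complex_of_real \<omega> + hyp_dir (s / k) * \<xi>))\<^sup>2"
    proof -
      have e1: "(s * k)\<^sup>2 = S * k\<^sup>2" "(s / k)\<^sup>2 = S / k\<^sup>2" by (simp_all add: S_def power_mult_distrib power_divide)
      define k2 where "k2 = k\<^sup>2"
      have k2: "k2 > 0" using k by (simp add: k2_def)
      have e2: "(S * k2 + 1 / (S * k2)) / 2 + (S / k2 + 1 / (S / k2)) / 2 = \<kappa> * K"
        and e3: "(S * k2 - 1 / (S * k2)) + (S / k2 - 1 / (S / k2)) = 2 * \<eta> * K"
        unfolding \<kappa>_def \<eta>_def K_def k2_def[symmetric] using S k2 by (simp_all add: field_simps)
      show ?thesis
        unfolding cmod_hyp_dir_combination[OF sk(1)] cmod_hyp_dir_combination[OF sk(2)] e1 k2_def[symmetric]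
          x1_def[symmetric] x2_def[symmetric] e2[symmetric]
        using arg_cong[OF e3, of "\<lambda>t. \<omega> * x2 * t"] by (simp add: algebra_simps)
    qed
    also have "\<dots> \<le> 4 * (a / w - 1) * (2 * p / w - 2)"
    proof -
      have "4 * (a / w - 1) * (2 * p / w - 2)
          = 4 * (a / w - 1) * (Re (hyp_dir (s * k) * \<mu>) - 1) + 4 * (a / w - 1) * (Re (hyp_dir (s / k) * \<mu>) - 1)"
        unfolding m[symmetric] by (simp add: algebra_simps)
      then show ?thesis using det[OF sk(1)] det[OF sk(2)] unfolding b1 b2 by linarith
    qed
    finally have sum: "\<kappa> * K * (\<omega>\<^sup>2 + x1\<^sup>2 + x2\<^sup>2) + 4 * \<omega> * x1 - 2 * \<omega> * \<eta> * K * x2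
        \<le> 4 * (a / w - 1) * (2 * p / w - 2)" .
    have "K * (D\<^sup>2 + d\<^sup>2) - 4 * (D * d) + K * ((\<kappa> * x2 - \<omega> * \<eta>)\<^sup>2 / \<kappa>)
        = \<kappa> * K * (\<omega>\<^sup>2 + x1\<^sup>2 + x2\<^sup>2) + 4 * \<omega> * x1 - 2 * \<omega> * \<eta> * K * x2"
    proof -
      have "\<omega>\<^sup>2 / \<kappa> + (\<kappa> * x2 - \<omega> * \<eta>)\<^sup>2 / \<kappa> = (\<omega>\<^sup>2 * (\<kappa>\<^sup>2 - \<eta>\<^sup>2) + (\<kappa> * x2 - \<omega> * \<eta>)\<^sup>2) / \<kappa>"
        unfolding \<kappa>\<eta> by (simp add: add_divide_distrib)
      also have "\<dots> = \<kappa> * (\<omega>\<^sup>2 + x2\<^sup>2) - 2 * \<omega> * \<eta> * x2"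
        using \<kappa> by (simp add: field_simps power2_eq_square)
      finally have "\<omega>\<^sup>2 / \<kappa> + (\<kappa> * x2 - \<omega> * \<eta>)\<^sup>2 / \<kappa> = \<kappa> * (\<omega>\<^sup>2 + x2\<^sup>2) - 2 * \<omega> * \<eta> * x2" .
      from arg_cong[OF this, of "\<lambda>t. K * t"] show ?thesis
        unfolding D2 d2 Dd by (simp add: algebra_simps)
    qed
    moreover have "0 \<le> K * ((\<kappa> * x2 - \<omega> * \<eta>)\<^sup>2 / \<kappa>)" using K0 \<kappa> by simp
    ultimately have "K * (D\<^sup>2 + d\<^sup>2) - 4 * (D * d) \<le> 4 * (a / w - 1) * (2 * p / w - 2)"
      using sum by linarith
    then have "w\<^sup>2 / 8 * (K * (D\<^sup>2 + d\<^sup>2) - 4 * (D * d)) \<le> w\<^sup>2 / 8 * (4 * (a / w - 1) * (2 * p / w - 2))"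
      by (intro mult_left_mono) auto
    moreover have "w\<^sup>2 / 8 * (4 * (a / w - 1) * (2 * p / w - 2)) = (p - w) * (a - w)"
      using w by (simp add: field_simps power2_eq_square)
    moreover have "w\<^sup>2 / 8 * (K * (D\<^sup>2 + d\<^sup>2) - 4 * (D * d)) = (D\<^sup>2 + d\<^sup>2) / 2 - w\<^sup>2 * (D + d)\<^sup>2 / 4"
      unfolding K using w by (simp add: field_simps power2_eq_square)
    ultimately show "(D\<^sup>2 + d\<^sup>2) / 2 - w\<^sup>2 * (D + d)\<^sup>2 / 4 \<le> (p - w) * (a - w)" by linarith
  qed
  also have "D * (a + p) \<le> \<omega> * cmod (\<beta> + \<mu>)"
  proof -
    define X where "X = a + \<alpha>"
    define X' where "X' = a + \<alpha>'"
    have sum: "Re (\<beta> + \<mu>) - Im (\<beta> + \<mu>) = X / s" "Re (\<beta> + \<mu>) + Im (\<beta> + \<mu>) = X' * s"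
    proof -
      have "Re \<mu> - Im \<mu> = \<alpha> / s" "Re \<mu> + Im \<mu> = \<alpha>' * s" using s by (simp_all add: \<alpha>_def \<alpha>'_def)
      then show "Re (\<beta> + \<mu>) - Im (\<beta> + \<mu>) = X / s" "Re (\<beta> + \<mu>) + Im (\<beta> + \<mu>) = X' * s"
        using P R by (simp_all add: X_def X'_def add_divide_distrib distrib_right)
    qed
    have "(cmod (\<beta> + \<mu>))\<^sup>2 = ((Re (\<beta> + \<mu>) - Im (\<beta> + \<mu>))\<^sup>2 + (Re (\<beta> + \<mu>) + Im (\<beta> + \<mu>))\<^sup>2) / 2"
      unfolding cmod_power2 by (simp add: power2_eq_square algebra_simps)
    also have "\<dots> = (X\<^sup>2 / S + X'\<^sup>2 * S) / 2"
      unfolding sum S_def by (simp add: power_divide power_mult_distrib)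
    finally have cm: "(cmod (\<beta> + \<mu>))\<^sup>2 = (X\<^sup>2 / S + X'\<^sup>2 * S) / 2" .
    have ap: "a + p = (X + X') / 2" by (simp add: X_def X'_def p_def)
    have "4 * (\<kappa> * (cmod (\<beta> + \<mu>))\<^sup>2 - (a + p)\<^sup>2) = (X / S - X' * S)\<^sup>2"
      unfolding cm ap \<kappa>_def using S by (simp add: field_simps power2_eq_square)
    then have "0 \<le> 4 * (\<kappa> * (cmod (\<beta> + \<mu>))\<^sup>2 - (a + p)\<^sup>2)" by simp
    then have "(a + p)\<^sup>2 \<le> \<kappa> * (cmod (\<beta> + \<mu>))\<^sup>2" by simp
    also have "\<dots> = (sqrt \<kappa> * cmod (\<beta> + \<mu>))\<^sup>2" using \<kappa> by (simp add: power_mult_distrib)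
    finally have "(a + p)\<^sup>2 \<le> (sqrt \<kappa> * cmod (\<beta> + \<mu>))\<^sup>2" .
    then have "a + p \<le> sqrt \<kappa> * cmod (\<beta> + \<mu>)"
      by (rule power2_le_imp_le) (use \<kappa> in simp)
    then have "D * (a + p) \<le> D * (sqrt \<kappa> * cmod (\<beta> + \<mu>))" using D by simp
    also have "\<dots> = \<omega> * cmod (\<beta> + \<mu>)" using \<kappa> by (simp add: D_def)
    finally show ?thesis .
  qed
  finally show ?thesis unfolding Dd using a2 by (simp add: x1_def algebra_simps)
qed

section \<open>Complex inner products\<close>

lemma scaleC_minus_one: "(-1) *\<^sub>C (x::'a::complex_inner) = - x"
  using scaleR_scaleC[of "-1" x] by simp

lemma scaleC_zero_left: "0 *\<^sub>C (x::'a::complex_inner) = 0"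
  using scaleR_scaleC[of 0 x] by simp

lemma diff_as_scaleC: "x - y = x + (-1) *\<^sub>C (y::'a::complex_inner)"
  by (simp add: scaleC_minus_one)

lemma cinner_add_right: "cinner x (y + z) = cinner x y + cinner x (z::'a::complex_inner)"
  by (metis cinner_add_left cinner_commute complex_cnj_add)

lemma cinner_scaleC_right: "cinner x (a *\<^sub>C y) = cnj a * cinner x (y::'a::complex_inner)"
  by (metis cinner_scaleC_left cinner_commute complex_cnj_mult)

lemma cinner_diff_left: "cinner (x - y) z = cinner x z - cinner y (z::'a::complex_inner)"
  unfolding diff_as_scaleC cinner_add_left cinner_scaleC_left by (simp add: scaleC_complex_def)

lemma cinner_diff_right: "cinner z (x - y) = cinner z x - cinner z (y::'a::complex_inner)"
  unfolding diff_as_scaleC cinner_add_right cinner_scaleC_right by (simp add: scaleC_complex_def)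

lemmas cinner_expand = cinner_add_left cinner_add_right cinner_diff_left cinner_diff_right
  cinner_scaleC_left cinner_scaleC_right

lemma cinner_self: "cinner x x = complex_of_real ((norm (x::'a::complex_inner))\<^sup>2)"
proof -
  have "Im (cinner x x) = 0" using arg_cong[OF cinner_commute[of x x], of Im] by simp
  then show ?thesis using cinner_ge_zero[of x] by (simp add: norm_eq_sqrt_cinner complex_eq_iff)
qed

lemma power2_norm_cinner: "(norm (x::'a::complex_inner))\<^sup>2 = Re (cinner x x)"
  by (simp add: cinner_self)

lemma scaleC_diff_right: "a *\<^sub>C (x - y) = a *\<^sub>C x - a *\<^sub>C (y::'a::complex_inner)"
  unfolding diff_as_scaleC scaleC_add_right scaleC_scaleC by (simp add: mult.commute)

lemma norm_scaleC: "norm (a *\<^sub>C x) = cmod a * norm (x::'a::complex_inner)"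
proof -
  have "cinner (a *\<^sub>C x) (a *\<^sub>C x) = complex_of_real ((cmod a)\<^sup>2 * (norm x)\<^sup>2)"
    unfolding cinner_scaleC_left cinner_scaleC_right cinner_self[of x]
    by (simp add: complex_norm_square mult.assoc del: of_real_power)
  then have "(norm (a *\<^sub>C x))\<^sup>2 = (cmod a * norm x)\<^sup>2"
    unfolding power2_norm_cinner[of "a *\<^sub>C x"] by (simp add: power_mult_distrib del: of_real_power of_real_mult)
  then show ?thesis by (rule power2_eq_imp_eq) simp_all
qed

lemma norm_scaleC_add:
  "(norm (a *\<^sub>C x + b *\<^sub>C (y::'a::complex_inner)))\<^sup>2
    = (cmod a)\<^sup>2 * (norm x)\<^sup>2 + (cmod b)\<^sup>2 * (norm y)\<^sup>2 + 2 * Re (a * cnj b * cinner x y)"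
proof -
  have "cinner y x = cnj (cinner x y)" by (rule cinner_commute)
  then have eq: "cinner (a *\<^sub>C x + b *\<^sub>C y) (a *\<^sub>C x + b *\<^sub>C y) = a * cnj a * cinner x x + b * cnj b * cinner y y
      + (a * cnj b * cinner x y + cnj (a * cnj b * cinner x y))"
    unfolding cinner_expand by (simp add: algebra_simps)
  have "(norm (a *\<^sub>C x + b *\<^sub>C y))\<^sup>2 = Re (a * cnj a * cinner x x + b * cnj b * cinner y y
      + (a * cnj b * cinner x y + cnj (a * cnj b * cinner x y)))"
    unfolding power2_norm_cinner eq ..
  also have "\<dots> = (cmod a)\<^sup>2 * (norm x)\<^sup>2 + (cmod b)\<^sup>2 * (norm y)\<^sup>2 + 2 * Re (a * cnj b * cinner x y)"
    unfolding cinner_self complex_norm_square[symmetric] complex_add_cnj by (simp only: plus_complex.sel Re_complex_of_real flip: of_real_mult)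
  finally show ?thesis .
qed

lemma bessel_two:
  fixes v y w :: "'a::complex_inner"
  assumes y: "norm y = 1" and w: "w \<noteq> 0" and yw: "cinner y w = 0"
  shows "(cmod (cinner v y))\<^sup>2 + (cmod (cinner v w))\<^sup>2 / (norm w)\<^sup>2 \<le> (norm v)\<^sup>2"
proof -
  define W where "W = (norm w)\<^sup>2"
  have W: "W > 0" using w by (simp add: W_def)
  define p where "p = cinner v y"
  define q where "q = cinner v w"
  have wy: "cinner w y = 0" using yw cinner_commute[of w y] by simp
  have c: "cinner y v = cnj p" "cinner w v = cnj q"
    by (simp_all add: p_def q_def flip: cinner_commute)
  have n: "cinner y y = 1" "cinner w w = complex_of_real W" "cinner v v = complex_of_real ((norm v)\<^sup>2)"
    unfolding cinner_self using y by (simp_all add: W_def)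
  have "cinner (v - p *\<^sub>C y - (q / W) *\<^sub>C w) (v - p *\<^sub>C y - (q / W) *\<^sub>C w)
      = complex_of_real ((norm v)\<^sup>2) - p * cnj p - q * cnj q / complex_of_real W"
    unfolding cinner_expand c n yw wy p_def[symmetric] q_def[symmetric] using W
    by (simp add: field_simps)
  also have "\<dots> = complex_of_real ((norm v)\<^sup>2 - (cmod p)\<^sup>2 - (cmod q)\<^sup>2 / W)"
    unfolding complex_norm_square[symmetric] by simp
  finally have "0 \<le> (norm v)\<^sup>2 - (cmod p)\<^sup>2 - (cmod q)\<^sup>2 / W"
    using cinner_ge_zero[of "v - p *\<^sub>C y - (q / W) *\<^sub>C w"] by (simp del: of_real_diff of_real_power)
  then show ?thesis unfolding p_def q_def W_def by simp
qed

section \<open>Discriminants and the Cauchy-Schwarz inequality\<close>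

lemma real_quadratic_discriminant:
  fixes a b c :: real
  assumes "\<And>t. 0 \<le> a * t\<^sup>2 + b * t + c"
  shows "b\<^sup>2 \<le> 4 * a * c"
proof -
  have c: "0 \<le> c" using assms[of 0] by simp
  consider "a > 0" | "a = 0" | "a < 0" by linarith
  then show ?thesis
  proof cases
    case 1
    have "a * (- b / (2 * a))\<^sup>2 + b * (- b / (2 * a)) + c = (4 * a * c - b\<^sup>2) / (4 * a)"
      using 1 by (simp add: field_simps power2_eq_square)
    then have "0 \<le> (4 * a * c - b\<^sup>2) / (4 * a)" using assms[of "- b / (2 * a)"] by simp
    then show ?thesis using 1 by (simp add: zero_le_divide_iff)
  next
    case 2
    have "b = 0"
    proof (rule ccontr)
      assume "b \<noteq> 0"
      then show False using assms[of "- (c + 1) / b"] 2 by simp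
    qed
    then show ?thesis using 2 by simp
  next
    case 3
    define t where "t = sqrt ((c + 1) / (- a))"
    have "0 \<le> (c + 1) / (- a)" using c 3 by (intro divide_nonneg_pos) auto
    then have "t\<^sup>2 = (c + 1) / (- a)" unfolding t_def by (rule real_sqrt_pow2)
    then have "a * t\<^sup>2 = - (c + 1)" using 3 by (simp add: field_simps)
    then show ?thesis using assms[of t] assms[of "- t"] by simp
  qed
qed

text \<open>
  On the line through the origin in the direction of \<open>z\<close> this is the real discriminant criterion.
\<close>

lemma complex_quadratic_discriminant:
  fixes A C :: real and z :: complex
  assumes H: "\<And>\<tau>. 0 \<le> A * (cmod \<tau>)\<^sup>2 + Re (cnj \<tau> * z) + C"
  shows "(cmod z)\<^sup>2 \<le> 4 * A * C"
proof (cases "z = 0")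
  case True
  have "0\<^sup>2 \<le> 4 * A * C"
  proof (rule real_quadratic_discriminant)
    fix t :: real
    show "0 \<le> A * t\<^sup>2 + 0 * t + C" using H[of "complex_of_real t"] True by simp
  qed
  then show ?thesis using True by simp
next
  case False
  define Z where "Z = (cmod z)\<^sup>2"
  have Z: "Z > 0" using False by (simp add: Z_def)
  have "(- Z)\<^sup>2 \<le> 4 * (A * Z) * C"
  proof (rule real_quadratic_discriminant)
    fix t :: real
    have "cnj (- complex_of_real t * z) * z = complex_of_real (- t * Z)"
      unfolding Z_def of_real_mult complex_norm_square by (simp add: mult_ac)
    then have "Re (cnj (- complex_of_real t * z) * z) = - t * Z" by (simp only: Re_complex_of_real)
    moreover have "(cmod (- complex_of_real t * z))\<^sup>2 = t\<^sup>2 * Z"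
      unfolding Z_def by (simp add: norm_mult power_mult_distrib)
    ultimately show "0 \<le> A * Z * t\<^sup>2 + - Z * t + C"
      using H[of "- complex_of_real t * z"] by (simp add: mult_ac)
  qed
  then have "Z * Z \<le> Z * (4 * A * C)" by (simp add: power2_eq_square mult_ac)
  then show ?thesis using Z unfolding Z_def by (simp only: mult_le_cancel_left_pos)
qed

lemma cauchy_schwarz:
  "(cmod (cinner v y))\<^sup>2 \<le> (norm v)\<^sup>2 * (norm (y::'a::complex_inner))\<^sup>2"
proof -
  have "(cmod (2 * cinner v y))\<^sup>2 \<le> 4 * (norm y)\<^sup>2 * (norm v)\<^sup>2"
  proof (rule complex_quadratic_discriminant)
    fix \<tau>
    have "0 \<le> (norm (1 *\<^sub>C v + \<tau> *\<^sub>C y))\<^sup>2" by simp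
    then show "0 \<le> (norm y)\<^sup>2 * (cmod \<tau>)\<^sup>2 + Re (cnj \<tau> * (2 * cinner v y)) + (norm v)\<^sup>2"
      unfolding norm_scaleC_add by (simp add: algebra_simps)
  qed
  then show ?thesis by (simp add: norm_mult power_mult_distrib mult_ac)
qed

section \<open>From matrices to vectors\<close>

text \<open>
  One should think of an operator \<open>B\<close> with \<open>b1 = B y\<close> and \<open>b2 = B (B y)\<close>, whose numerical range on the
  span of \<open>y\<close> and \<open>B y\<close> lies right of the hyperbola \<open>x\<^sup>2 - y\<^sup>2 = 1\<close>; the conclusion concerns \<open>C = B\<^sup>2 - 1\<close>. It
  is formulated with vectors only, because the operator to which it will be applied need not be defined
  everywhere. Write \<open>b1 = \<beta> y + w\<close> with \<open>w\<close> orthogonal to \<open>y\<close>. Positivity at all vectors \<open>\<tau> y + w\<close> is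
  a discriminant condition, \<open>two_by_two_estimate\<close> bounds the component of \<open>C y\<close> along \<open>y\<close> by the one
  along \<open>w\<close>, and Bessel's inequality adds up the two components.
\<close>

lemma hyperbola_estimate_unit:
  fixes y b1 b2 :: "'a::complex_inner"
  assumes y: "norm y = 1"
    and H: "\<And>u \<rho> \<nu>. u > 0 \<Longrightarrow>
      (norm (\<rho> *\<^sub>C y + \<nu> *\<^sub>C b1))\<^sup>2 \<le> Re (hyp_dir u * cinner (\<rho> *\<^sub>C b1 + \<nu> *\<^sub>C b2) (\<rho> *\<^sub>C y + \<nu> *\<^sub>C b1))"
    and neg: "Re (cinner (b2 - y) y) \<le> 0"
  shows "9 * (Re (cinner (b2 - y) y))\<^sup>2 + (Im (cinner (b2 - y) y))\<^sup>2 \<le> (norm (b2 - y))\<^sup>2"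
proof -
  define \<beta> where "\<beta> = cinner b1 y"
  define w where "w = b1 - \<beta> *\<^sub>C y"
  define g where "g = b2 - \<beta> *\<^sub>C b1"
  define \<zeta> where "\<zeta> = cinner g y"
  define G where "G = cinner g w"
  define W where "W = (norm w)\<^sup>2"
  define z where "z = cinner (b2 - y) y"
  have yy: "cinner y y = 1" unfolding cinner_self y by simp
  have wy: "cinner w y = 0" unfolding w_def cinner_expand yy \<beta>_def[symmetric] by simp
  have yw: "cinner y w = 0" using wy cinner_commute[of y w] by simp
  have ww: "cinner w w = complex_of_real W" unfolding cinner_self W_def ..
  have b1: "b1 = \<beta> *\<^sub>C y + w" by (simp add: w_def)
  have b1w: "cinner b1 w = complex_of_real W" unfolding b1 cinner_expand yw ww by simp
  have b2: "b2 = g + \<beta> *\<^sub>C b1" by (simp add: g_def)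
  have \<beta>: "1 \<le> Re (hyp_dir u * \<beta>)" if "u > 0" for u
    using H[OF that, of 1 0] y
    by (simp add: \<beta>_def scaleC_one scaleC_zero_left)
  have form: "0 \<le> (Re (hyp_dir u * \<beta>) - 1) * (cmod \<tau>)\<^sup>2
      + Re (cnj \<tau> * (cnj (hyp_dir u) * complex_of_real W + hyp_dir u * \<zeta>)) + (Re (hyp_dir u * G) - W)"
    if "u > 0" for u \<tau>
  proof -
    have v: "(\<tau> - \<beta>) *\<^sub>C y + 1 *\<^sub>C b1 = \<tau> *\<^sub>C y + 1 *\<^sub>C w"
      unfolding w_def scaleC_one using scaleC_add_left[of "\<tau> - \<beta>" \<beta> y] by (simp add: algebra_simps)
    have v2: "(\<tau> - \<beta>) *\<^sub>C b1 + 1 *\<^sub>C b2 = \<tau> *\<^sub>C b1 + g"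
      unfolding g_def scaleC_one using scaleC_add_left[of "\<tau> - \<beta>" \<beta> b1] by (simp add: algebra_simps)
    have n: "(norm (\<tau> *\<^sub>C y + 1 *\<^sub>C w))\<^sup>2 = (cmod \<tau>)\<^sup>2 + W"
      unfolding norm_scaleC_add yw y W_def by simp
    have i: "cinner (\<tau> *\<^sub>C b1 + g) (\<tau> *\<^sub>C y + 1 *\<^sub>C w)
        = complex_of_real ((cmod \<tau>)\<^sup>2) * \<beta> + \<tau> * complex_of_real W + cnj \<tau> * \<zeta> + G"
      unfolding cinner_expand b1w \<beta>_def[symmetric] \<zeta>_def[symmetric] G_def[symmetric] complex_norm_square
      by (simp add: algebra_simps)
    have "(cmod \<tau>)\<^sup>2 + W \<le> Re (hyp_dir u * (complex_of_real ((cmod \<tau>)\<^sup>2) * \<beta> + \<tau> * complex_of_real W + cnj \<tau> * \<zeta> + G))"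
      using H[OF that, of "\<tau> - \<beta>" 1] unfolding v v2 n i .
    also have "\<dots> = Re (hyp_dir u * \<beta>) * (cmod \<tau>)\<^sup>2
        + Re (cnj \<tau> * (cnj (hyp_dir u) * complex_of_real W + hyp_dir u * \<zeta>)) + Re (hyp_dir u * G)"
      by (simp add: algebra_simps)
    finally show ?thesis by (simp add: algebra_simps)
  qed
  have det: "(cmod (cnj (hyp_dir u) * complex_of_real W + hyp_dir u * \<zeta>))\<^sup>2
      \<le> 4 * (Re (hyp_dir u * \<beta>) - 1) * (Re (hyp_dir u * G) - W)" if "u > 0" for u
    using form[OF that] by (rule complex_quadratic_discriminant)
  have z: "z = \<zeta> + \<beta>\<^sup>2 - 1"
    unfolding z_def b2 cinner_expand yy \<zeta>_def \<beta>_def by (simp add: power2_eq_square)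
  have zsq: "(cmod z)\<^sup>2 = (Re z)\<^sup>2 + (Im z)\<^sup>2" by (rule cmod_power2)
  have neg': "Re z \<le> 0" using neg unfolding z_def .
  have "9 * (Re z)\<^sup>2 + (Im z)\<^sup>2 \<le> (norm (b2 - y))\<^sup>2"
  proof (cases "w = 0")
    case True
    \<comment> \<open>Here \<open>y\<close> is an eigenvector, and the discriminant condition forces \<open>\<zeta> = 0\<close>.\<close>
    then have "W = 0" "G = 0" using ww by (simp_all add: W_def G_def cinner_self) (metis cinner_diff_right diff_self)
    then have "(cmod (hyp_dir 1 * \<zeta>))\<^sup>2 \<le> 0" using det[of 1] by simp
    then have "\<zeta> = 0" by (simp add: hyp_dir_def complex_eq_iff)
    moreover have "1 \<le> Re (\<beta>\<^sup>2)"
    proof -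
      obtain a s where "1 \<le> a" "Re (\<beta>\<^sup>2) = a\<^sup>2" using hyperbola_coordinates[OF \<beta>] by metis
      then show ?thesis by simp
    qed
    ultimately have "Re z = 0" using neg' by (simp add: z)
    then show ?thesis using cauchy_schwarz[of "b2 - y" y] y zsq unfolding z_def by simp
  next
    case False
    define \<omega> where "\<omega> = norm w"
    have \<omega>: "\<omega> > 0" "W = \<omega>\<^sup>2" using False by (simp_all add: \<omega>_def W_def)
    define \<xi> where "\<xi> = \<zeta> / complex_of_real \<omega>"
    define \<mu> where "\<mu> = G / complex_of_real W"
    have \<zeta>: "\<zeta> = complex_of_real \<omega> * \<xi>" using \<omega> by (simp add: \<xi>_def)
    have G: "G = complex_of_real W * \<mu>" using \<omega> by (simp add: \<mu>_def)
    have "2 * sqrt 2 * (1 - Re (\<beta>\<^sup>2 + complex_of_real \<omega> * \<xi>)) \<le> \<omega> * cmod (\<beta> + \<mu>)"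
    proof (rule two_by_two_estimate[OF \<omega>(1) \<beta>])
      fix u :: real
      assume u: "u > 0"
      define e where "e = hyp_dir u"
      have e1: "cnj e * complex_of_real W + e * \<zeta> = complex_of_real \<omega> * (cnj e * complex_of_real \<omega> + e * \<xi>)"
        unfolding \<omega>(2) \<zeta> by (simp add: algebra_simps power2_eq_square)
      have "W * (cmod (cnj e * complex_of_real \<omega> + e * \<xi>))\<^sup>2 = (cmod (cnj e * complex_of_real W + e * \<zeta>))\<^sup>2"
        unfolding e1 by (simp add: norm_mult power_mult_distrib \<omega>(2))
      also have "\<dots> \<le> 4 * (Re (e * \<beta>) - 1) * (Re (e * G) - W)" unfolding e_def by (rule det[OF u])
      also have "Re (e * G) - W = W * (Re (e * \<mu>) - 1)" unfolding G by (simp add: algebra_simps)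
      finally have "W * (cmod (cnj e * complex_of_real \<omega> + e * \<xi>))\<^sup>2
          \<le> W * (4 * (Re (e * \<beta>) - 1) * (Re (e * \<mu>) - 1))" by (simp only: mult_ac)
      then show "(cmod (cnj (hyp_dir u) * complex_of_real \<omega> + hyp_dir u * \<xi>))\<^sup>2
          \<le> 4 * (Re (hyp_dir u * \<beta>) - 1) * (Re (hyp_dir u * \<mu>) - 1)"
        using \<omega> unfolding e_def by (simp only: mult_le_cancel_left_pos zero_less_power)
    qed
    then have est: "- (2 * sqrt 2 * Re z) \<le> \<omega> * cmod (\<beta> + \<mu>)" unfolding z \<zeta> by (simp add: algebra_simps)
    have "0 \<le> - (2 * sqrt 2 * Re z)" using neg' by (simp add: mult_nonneg_nonpos)
    then have "(- (2 * sqrt 2 * Re z))\<^sup>2 \<le> (\<omega> * cmod (\<beta> + \<mu>))\<^sup>2"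
      by (rule power_mono[OF est])
    then have e8: "8 * (Re z)\<^sup>2 \<le> W * (cmod (\<beta> + \<mu>))\<^sup>2"
      unfolding \<omega>(2) power2_minus power_mult_distrib by simp
    have "cinner (b2 - y) w = complex_of_real W * (\<beta> + \<mu>)"
      unfolding b2 cinner_expand yw b1w G_def[symmetric] G by (simp add: algebra_simps)
    then have "(cmod (cinner (b2 - y) w))\<^sup>2 / W = W * (cmod (\<beta> + \<mu>))\<^sup>2"
      using \<omega> by (simp add: norm_mult power_mult_distrib power2_eq_square)
    then have "(cmod z)\<^sup>2 + W * (cmod (\<beta> + \<mu>))\<^sup>2 \<le> (norm (b2 - y))\<^sup>2"
      using bessel_two[OF y False yw, of "b2 - y"] unfolding z_def W_def by simp
    then show ?thesis using e8 zsq by linarith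
  qed
  then show ?thesis unfolding z_def .
qed

lemma hyperbola_estimate:
  fixes y b1 b2 :: "'a::complex_inner"
  assumes H: "\<And>u \<rho> \<nu>. u > 0 \<Longrightarrow>
      (norm (\<rho> *\<^sub>C y + \<nu> *\<^sub>C b1))\<^sup>2 \<le> Re (hyp_dir u * cinner (\<rho> *\<^sub>C b1 + \<nu> *\<^sub>C b2) (\<rho> *\<^sub>C y + \<nu> *\<^sub>C b1))"
    and neg: "Re (cinner (b2 - y) y) \<le> 0"
  shows "9 * (Re (cinner (b2 - y) y))\<^sup>2 + (Im (cinner (b2 - y) y))\<^sup>2 \<le> (norm (b2 - y))\<^sup>2 * (norm y)\<^sup>2"
proof (cases "y = 0")
  case True
  have "cinner (b2 - y) y = 0" using cinner_diff_right[of "b2 - y" y y] True by simp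
  then show ?thesis by simp
next
  case False
  define t where "t = 1 / norm y"
  have t: "t > 0" "t * norm y = 1" using False by (simp_all add: t_def)
  define s where "s = complex_of_real t"
  have n: "norm (s *\<^sub>C y) = 1" using t by (simp add: norm_scaleC s_def)
  have i: "cinner (s *\<^sub>C b2 - s *\<^sub>C y) (s *\<^sub>C y) = complex_of_real (t\<^sup>2) * cinner (b2 - y) y"
    by (simp add: cinner_expand s_def power2_eq_square algebra_simps)
  have d: "s *\<^sub>C b2 - s *\<^sub>C y = s *\<^sub>C (b2 - y)" by (simp add: scaleC_diff_right)
  have "9 * (Re (cinner (s *\<^sub>C b2 - s *\<^sub>C y) (s *\<^sub>C y)))\<^sup>2 + (Im (cinner (s *\<^sub>C b2 - s *\<^sub>C y) (s *\<^sub>C y)))\<^sup>2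
      \<le> (norm (s *\<^sub>C b2 - s *\<^sub>C y))\<^sup>2"
  proof (rule hyperbola_estimate_unit[OF n])
    fix u :: real and \<rho> \<nu>
    assume u: "u > 0"
    show "(norm (\<rho> *\<^sub>C s *\<^sub>C y + \<nu> *\<^sub>C s *\<^sub>C b1))\<^sup>2
      \<le> Re (hyp_dir u * cinner (\<rho> *\<^sub>C s *\<^sub>C b1 + \<nu> *\<^sub>C s *\<^sub>C b2) (\<rho> *\<^sub>C s *\<^sub>C y + \<nu> *\<^sub>C s *\<^sub>C b1))"
      using H[OF u, of "\<rho> * s" "\<nu> * s"] unfolding scaleC_scaleC .
  next
    show "Re (cinner (s *\<^sub>C b2 - s *\<^sub>C y) (s *\<^sub>C y)) \<le> 0"
      unfolding i using neg by (simp add: mult_nonneg_nonpos del: of_real_power)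
  qed
  then have "t\<^sup>2 * t\<^sup>2 * (9 * (Re (cinner (b2 - y) y))\<^sup>2 + (Im (cinner (b2 - y) y))\<^sup>2) \<le> t\<^sup>2 * (norm (b2 - y))\<^sup>2"
    unfolding i unfolding d norm_scaleC
    by (simp add: s_def power_mult_distrib algebra_simps del: of_real_power)
  then have le: "t\<^sup>2 * (t\<^sup>2 * (9 * (Re (cinner (b2 - y) y))\<^sup>2 + (Im (cinner (b2 - y) y))\<^sup>2)) \<le> t\<^sup>2 * (norm (b2 - y))\<^sup>2"
    by (simp only: mult.assoc)
  have t0: "0 < t\<^sup>2" using t by simp
  have "t\<^sup>2 * (norm y)\<^sup>2 = 1" using t(2) by (metis one_power2 power_mult_distrib)
  then have "t\<^sup>2 * ((norm (b2 - y))\<^sup>2 * (norm y)\<^sup>2) = (norm (b2 - y))\<^sup>2"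
    by (metis mult.left_commute mult.right_neutral)
  then have "t\<^sup>2 * (9 * (Re (cinner (b2 - y) y))\<^sup>2 + (Im (cinner (b2 - y) y))\<^sup>2)
      \<le> t\<^sup>2 * ((norm (b2 - y))\<^sup>2 * (norm y)\<^sup>2)"
    using le t0 by (simp only: mult_le_cancel_left_pos)
  then show ?thesis using t0 by (simp only: mult_le_cancel_left_pos)
qed

lemma Re_cinner_le: "Re (cinner v y) \<le> norm v * norm (y::'a::complex_inner)"
proof -
  have "cmod (cinner v y) \<le> norm v * norm y"
    using cauchy_schwarz[of v y] unfolding power_mult_distrib[symmetric] by (rule power2_le_imp_le) simp
  then show ?thesis using complex_Re_le_cmod order_trans by blast
qed

section \<open>The estimate for a Moebius family\<close>

text \<open>
  For \<open>h\<close> and \<open>y\<close> fixed, the assertion for all \<open>c\<close> in the unit disc reduces to one condition on the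
  inner product \<open>r + i s\<close> of \<open>h\<close> and \<open>y\<close>, and \<open>c\<close> can be eliminated: the difference of the two sides is
  \<open>X + Y + 12 m r - 8 k s\<close> with \<open>m = 1 - |c|\<^sup>2\<close> and \<open>k = Im c\<close>, the product \<open>X Y\<close> contains the factor
  \<open>|1 - c\<^sup>2|\<^sup>2 = m\<^sup>2 + 4 k\<^sup>2\<close>, and the rest is the inequality of the means and Cauchy-Schwarz. The factor \<open>9\<close> is
  exactly the one needed if \<open>r \<le> 0\<close>; for \<open>r > 0\<close> Cauchy-Schwarz is enough.
\<close>

lemma moebius_norm_estimate:
  fixes h y :: "'a::complex_inner"
  assumes c: "cmod c \<le> 1"
    and est: "Re (cinner h y) \<le> 0 \<Longrightarrow>
      9 * (Re (cinner h y))\<^sup>2 + (Im (cinner h y))\<^sup>2 \<le> (norm h)\<^sup>2 * (norm y)\<^sup>2"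
  shows "(norm ((1 + cnj c) *\<^sub>C h + (- (2 * (1 - cnj c))) *\<^sub>C y))\<^sup>2
      \<le> 2 * (norm ((1 + c) *\<^sub>C h + (2 * (1 - c)) *\<^sub>C y))\<^sup>2"
proof -
  define r where "r = Re (cinner h y)"
  define s where "s = Im (cinner h y)"
  define m where "m = 1 - (cmod c)\<^sup>2"
  define k where "k = Im c"
  define ab where "ab = (norm h)\<^sup>2 * (norm y)\<^sup>2"
  define X where "X = (cmod (1 + c))\<^sup>2 * (norm h)\<^sup>2"
  define Y where "Y = 4 * (cmod (1 - c))\<^sup>2 * (norm y)\<^sup>2"
  have m: "0 \<le> m" using c by (simp add: m_def power_le_one)
  have cs: "r\<^sup>2 + s\<^sup>2 \<le> ab" using cauchy_schwarz[of h y] by (simp add: cmod_power2 r_def s_def ab_def)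
  have mk: "(cmod (1 + c))\<^sup>2 * (cmod (1 - c))\<^sup>2 = m\<^sup>2 + 4 * k\<^sup>2"
    unfolding m_def k_def cmod_power2 by (simp add: power2_eq_square algebra_simps)
  have XY: "16 * ((m\<^sup>2 + 4 * k\<^sup>2) * ab) \<le> (X + Y)\<^sup>2"
  proof -
    have "16 * ((m\<^sup>2 + 4 * k\<^sup>2) * ab) = 4 * (X * Y)" unfolding mk[symmetric] X_def Y_def ab_def by (simp add: mult_ac)
    also have "\<dots> \<le> (X + Y)\<^sup>2" using zero_le_power2[of "X - Y"] by (simp add: power2_eq_square algebra_simps)
    finally show ?thesis .
  qed
  have XY0: "0 \<le> X + Y" unfolding X_def Y_def by simp
  have main: "0 \<le> X + Y + 12 * (m * r) - 8 * (k * s)"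
  proof (cases "r \<le> 0")
    case True
    have "(m\<^sup>2 + 4 * k\<^sup>2) * (9 * r\<^sup>2 + s\<^sup>2) \<le> (m\<^sup>2 + 4 * k\<^sup>2) * ab"
      using est True unfolding r_def s_def ab_def by (intro mult_left_mono) auto
    moreover have "(m\<^sup>2 + 4 * k\<^sup>2) * (9 * r\<^sup>2 + s\<^sup>2) = (3 * (m * r) - 2 * (k * s))\<^sup>2 + (m * s + 6 * (k * r))\<^sup>2"
      by (simp add: power2_eq_square algebra_simps)
    moreover have "0 \<le> (m * s + 6 * (k * r))\<^sup>2" by simp
    ultimately have "16 * (3 * (m * r) - 2 * (k * s))\<^sup>2 \<le> (X + Y)\<^sup>2" using XY by argo
    moreover have "16 * (3 * (m * r) - 2 * (k * s))\<^sup>2 = (8 * (k * s) - 12 * (m * r))\<^sup>2"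
      by (simp add: power2_eq_square algebra_simps)
    ultimately have "(8 * (k * s) - 12 * (m * r))\<^sup>2 \<le> (X + Y)\<^sup>2" by simp
    then have "8 * (k * s) - 12 * (m * r) \<le> X + Y" using XY0 by (rule power2_le_imp_le)
    then show ?thesis by simp
  next
    case False
    have "(4 * k\<^sup>2) * s\<^sup>2 \<le> (m\<^sup>2 + 4 * k\<^sup>2) * ab"
      using cs by (intro mult_mono) (auto intro: order_trans[rotated])
    then have "16 * ((4 * k\<^sup>2) * s\<^sup>2) \<le> (X + Y)\<^sup>2" using XY by linarith
    then have "(8 * (k * s))\<^sup>2 \<le> (X + Y)\<^sup>2" by (simp add: power_mult_distrib)
    then have "8 * (k * s) \<le> X + Y" using XY0 by (rule power2_le_imp_le)
    moreover have "0 \<le> m * r" using m False by simp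
    ultimately show ?thesis by simp
  qed
  have c1: "cmod (1 + cnj c) = cmod (1 + c)" "cmod (1 - cnj c) = cmod (1 - c)"
    by (metis complex_cnj_add complex_cnj_one complex_mod_cnj)
       (metis complex_cnj_diff complex_cnj_one complex_mod_cnj)
  have z: "cinner h y = Complex r s" by (simp add: r_def s_def complex_eq_iff)
  have d1: "Re ((1 + cnj c) * cnj (- (2 * (1 - cnj c))) * cinner h y) = - 2 * (m * r) - 4 * (k * s)"
    unfolding z m_def k_def cmod_power2 by (simp add: power2_eq_square algebra_simps)
  have d2: "Re ((1 + c) * cnj (2 * (1 - c)) * cinner h y) = 2 * (m * r) - 4 * (k * s)"
    unfolding z m_def k_def cmod_power2 by (simp add: power2_eq_square algebra_simps)
  have n1: "(norm ((1 + cnj c) *\<^sub>C h + (- (2 * (1 - cnj c))) *\<^sub>C y))\<^sup>2 = X + Y - 4 * (m * r) - 8 * (k * s)"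
    unfolding norm_scaleC_add d1 norm_minus_cancel norm_mult c1 X_def Y_def by (simp add: power_mult_distrib)
  have n2: "(norm ((1 + c) *\<^sub>C h + (2 * (1 - c)) *\<^sub>C y))\<^sup>2 = X + Y + 4 * (m * r) - 8 * (k * s)"
    unfolding norm_scaleC_add d2 norm_mult X_def Y_def by (simp add: power_mult_distrib)
  show ?thesis unfolding n1 n2 using main by argo
qed

section \<open>Operators with numerical range in the sector\<close>

lemma bounded_clinearD:
  assumes "bounded_clinear T"
  shows "T (x + y) = T x + T y" "T (x - y) = T x - T y" "T (a *\<^sub>C x) = a *\<^sub>C T x" "T 0 = 0"
    "bounded_linear T"
  using assms unfolding bounded_clinear_def
  by (auto simp: bounded_linear.linear linear_add linear_diff linear_0)

lemma sector_subset_cone: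
  assumes "z \<in> sector (pi / 4)" shows "\<bar>Im z\<bar> \<le> Re z"
proof -
  obtain r \<theta> where z: "z = rcis r \<theta>" and r: "0 \<le> r" and \<theta>: "\<bar>\<theta>\<bar> \<le> pi / 4"
    using assms unfolding sector_def by blast
  have "0 \<le> sin \<bar>\<theta>\<bar>" using \<theta> by (intro sin_ge_zero) auto
  then have "\<bar>sin \<theta>\<bar> = sin \<bar>\<theta>\<bar>" by (cases "0 \<le> \<theta>") simp_all
  also have "\<dots> \<le> sin (pi / 4)" using \<theta> by (intro sin_monotone_2pi_le) auto
  also have "\<dots> = cos (pi / 4)" by (simp add: sin_45 cos_45)
  also have "\<dots> \<le> cos \<bar>\<theta>\<bar>" using \<theta> by (intro cos_monotone_0_pi_le) auto
  also have "cos \<bar>\<theta>\<bar> = cos \<theta>" by (simp add: abs_if)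
  finally have "r * \<bar>sin \<theta>\<bar> \<le> r * cos \<theta>" using r by (rule mult_left_mono)
  then show ?thesis using r by (simp add: z rcis_def cis.ctr abs_mult)
qed

lemma numerical_range_sector:
  assumes T: "bounded_clinear T" and W: "numerical_range T \<subseteq> sector (pi / 4)"
  shows "\<bar>Im (cinner (T x) x)\<bar> \<le> Re (cinner (T x) x)"
proof (cases "x = 0")
  case True
  then show ?thesis using bounded_clinearD(4)[OF T] by (simp add: cinner_self)
next
  case False
  define s where "s = complex_of_real (1 / norm x)"
  have "norm (s *\<^sub>C x) = 1" using False by (simp add: norm_scaleC s_def norm_divide)
  then have "cinner (T (s *\<^sub>C x)) (s *\<^sub>C x) \<in> sector (pi / 4)"
    using W unfolding numerical_range_def by blast
  then have le: "\<bar>Im (cinner (T (s *\<^sub>C x)) (s *\<^sub>C x))\<bar> \<le> Re (cinner (T (s *\<^sub>C x)) (s *\<^sub>C x))"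
    by (rule sector_subset_cone)
  have eq: "cinner (T (s *\<^sub>C x)) (s *\<^sub>C x) = complex_of_real ((1 / norm x)\<^sup>2) * cinner (T x) x"
    unfolding bounded_clinearD(3)[OF T] cinner_expand s_def by (simp add: power2_eq_square)
  have pos: "0 < (1 / norm x)\<^sup>2" using False by simp
  have "(1 / norm x)\<^sup>2 * \<bar>Im (cinner (T x) x)\<bar> \<le> (1 / norm x)\<^sup>2 * Re (cinner (T x) x)"
    using le unfolding eq Re_complex_of_real Im_complex_of_real times_complex.sel by (simp add: abs_mult)
  then show ?thesis using pos by (simp only: mult_le_cancel_left_pos)
qed

text \<open>
  For invertible \<open>T\<close> and \<open>v = T z\<close> this says that \<open>T + T\<inverse>\<close> has its numerical range right of the
  hyperbola \<open>x\<^sup>2 - y\<^sup>2 = 2\<close>, the image of the boundary rays of the sector under \<open>z + 1 / z\<close>. The sector condition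
  consists of the two half-planes \<open>Re z - Im z \<ge> 0\<close> and \<open>Re z + Im z \<ge> 0\<close>. The first one is used at
  \<open>z + a v\<close>, the second at \<open>z + b v\<close>, where \<open>a\<close> and \<open>b\<close> are chosen such that in a suitable positive
  combination the terms with \<open>q\<close> cancel and the terms with \<open>n\<close> add up to \<open>- sqrt 2 n\<close>.
\<close>

lemma hyperbola_form:
  fixes T :: "'a::complex_inner \<Rightarrow> 'a"
  assumes T: "bounded_clinear T" and S: "\<And>x. \<bar>Im (cinner (T x) x)\<bar> \<le> Re (cinner (T x) x)"
    and u: "u > 0"
  shows "sqrt 2 * (norm (T z))\<^sup>2 \<le> Re (hyp_dir u * cinner (T (T z) + z) (T z))"
proof -
  define v where "v = T z"
  define p where "p = cinner v z"
  define q where "q = cinner (T v) z"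
  define r where "r = cinner (T v) v"
  define n where "n = (norm v)\<^sup>2"
  define f where "f \<gamma> = cinner (T (z + \<gamma> *\<^sub>C v)) (z + \<gamma> *\<^sub>C v)" for \<gamma>
  have f: "f \<gamma> = p + cnj \<gamma> * complex_of_real n + \<gamma> * q + complex_of_real ((cmod \<gamma>)\<^sup>2) * r" for \<gamma>
    unfolding f_def bounded_clinearD(1,3)[OF T] v_def[symmetric] cinner_expand
      p_def[symmetric] q_def[symmetric] r_def[symmetric] complex_norm_square cinner_self n_def[symmetric]
    by (simp add: algebra_simps)
  define g where "g = sqrt 2 / 2"
  have g: "2 * (g * g) = 1" by (simp add: g_def)
  \<comment> \<open>Complex numbers of modulus \<open>u\<close> and \<open>1 / u\<close>; their arguments make the terms with \<open>q\<close> cancel.\<close>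
  define a where "a = Complex (- (g * u)) (- (g * u))"
  define b where "b = Complex (- (g / u)) (g / u)"
  have ca: "(cmod a)\<^sup>2 = u\<^sup>2" unfolding cmod_power2 a_def using g by (simp add: power_mult_distrib power2_eq_square)
  have cb: "(cmod b)\<^sup>2 = 1 / u\<^sup>2" unfolding cmod_power2 b_def using g
    by (simp add: power_divide power2_eq_square flip: add_divide_distrib)
  have fa: "Re (f a) - Im (f a) = Re p - Im p - 2 * g * u * n + 2 * g * u * Im q + u\<^sup>2 * (Re r - Im r)"
    unfolding f ca by (simp add: a_def algebra_simps)
  have fb: "Re (f b) + Im (f b) = Re p + Im p - 2 * g / u * n - 2 * g / u * Im q + (Re r + Im r) / u\<^sup>2"
    unfolding f cb using u by (simp add: b_def add_divide_distrib algebra_simps)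
  have "0 \<le> (Re (f a) - Im (f a)) / (2 * u) + (Re (f b) + Im (f b)) * u / 2"
  proof -
    have "0 \<le> Re (f a) - Im (f a)" "0 \<le> Re (f b) + Im (f b)"
      using S[of "z + a *\<^sub>C v"] S[of "z + b *\<^sub>C v"] unfolding f_def[symmetric] by linarith+
    then show ?thesis using u by simp
  qed
  also have "\<dots> = (u * (Re r - Im r) + (Re r + Im r) / u) / 2 + (u * (Re p + Im p) + (Re p - Im p) / u) / 2 - 2 * g * n"
    unfolding fa fb using u by (simp add: field_simps power2_eq_square)
  also have "\<dots> = Re (hyp_dir u * r) + Re (hyp_dir u * cnj p) - sqrt 2 * n"
    unfolding Re_hyp_dir_mult by (simp add: g_def)
  finally have "sqrt 2 * n \<le> Re (hyp_dir u * (r + cnj p))" by (simp add: algebra_simps)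
  moreover have "cinner (T (T z) + z) (T z) = r + cnj p"
    unfolding cinner_expand r_def p_def v_def by (simp flip: cinner_commute)
  ultimately show ?thesis unfolding n_def v_def by simp
qed

text \<open>
  Formally \<open>B = (T + T\<inverse>) / sqrt 2\<close> satisfies \<open>B\<^sup>2 - 1 = (T\<^sup>2 + T\<^sup>-\<^sup>2) / 2\<close>, which maps \<open>y = T\<^sup>2 x\<close> to
  \<open>h / 2\<close>. Starting from \<open>y = T\<^sup>2 x\<close>, all vectors that occur lie in the range of \<open>T\<close>, so that \<open>T\<close> need
  not be invertible.
\<close>

lemma sector_estimate:
  fixes T :: "'a::complex_inner \<Rightarrow> 'a" and x :: 'a
  assumes T: "bounded_clinear T" and S: "\<And>x. \<bar>Im (cinner (T x) x)\<bar> \<le> Re (cinner (T x) x)"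
  defines "y \<equiv> T (T x)" and "h \<equiv> T (T (T (T x))) + x"
  assumes neg: "Re (cinner h y) \<le> 0"
  shows "9 * (Re (cinner h y))\<^sup>2 + (Im (cinner h y))\<^sup>2 \<le> (norm h)\<^sup>2 * (norm y)\<^sup>2"
proof -
  note T' = bounded_clinearD(1,3)[OF T]
  define t1 where "t1 = T x"
  define t3 where "t3 = T y"
  define t4 where "t4 = T t3"
  have y: "y = T t1" by (simp add: y_def t1_def)
  have h: "h = t4 + x" by (simp add: h_def t4_def t3_def y_def)
  define s where "s = complex_of_real (1 / sqrt 2)"
  have ss: "s * s = 1 / 2" by (simp add: s_def flip: of_real_mult)
  define b1 where "b1 = s *\<^sub>C (t3 + t1)"
  define b2 where "b2 = (1 / 2) *\<^sub>C (t4 + y + (y + x))"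
  have half: "(1 / 2) *\<^sub>C (v + v) = v" for v :: 'a
    unfolding scaleC_add_right using scaleC_add_left[of "1/2" "1/2" v] by (simp add: scaleC_one)
  have b2y: "b2 - y = (1 / 2) *\<^sub>C h"
  proof -
    have "b2 = (1 / 2) *\<^sub>C (h + (y + y))" unfolding b2_def h by (simp add: add_ac)
    also have "\<dots> = (1 / 2) *\<^sub>C h + y" unfolding scaleC_add_right[of _ h] half ..
    finally show ?thesis by simp
  qed
  have "9 * (Re (cinner (b2 - y) y))\<^sup>2 + (Im (cinner (b2 - y) y))\<^sup>2 \<le> (norm (b2 - y))\<^sup>2 * (norm y)\<^sup>2"
  proof (rule hyperbola_estimate)
    fix u :: real and \<rho> \<nu>
    assume u: "u > 0"
    define z where "z = \<rho> *\<^sub>C t1 + (\<nu> * s) *\<^sub>C (y + x)"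
    have 1: "\<rho> *\<^sub>C y + \<nu> *\<^sub>C b1 = T z"
      unfolding z_def T' b1_def y t3_def t1_def scaleC_scaleC ..
    have 2: "\<rho> *\<^sub>C b1 + \<nu> *\<^sub>C b2 = s *\<^sub>C (T (T z) + z)"
    proof -
      have "T (T z) + z = \<rho> *\<^sub>C (t3 + t1) + (\<nu> * s) *\<^sub>C (t4 + y + (y + x))"
        unfolding z_def T' scaleC_add_right y[symmetric] t3_def[symmetric] t4_def[symmetric] t1_def[symmetric]
        by (simp add: add_ac)
      then have "s *\<^sub>C (T (T z) + z) = (s * \<rho>) *\<^sub>C (t3 + t1) + (s * (\<nu> * s)) *\<^sub>C (t4 + y + (y + x))"
        by (simp only: scaleC_add_right scaleC_scaleC)
      moreover have "s * (\<nu> * s) = \<nu> * (1 / 2)" using ss by (metis mult.commute mult.left_commute)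
      ultimately show ?thesis unfolding b1_def b2_def scaleC_scaleC by (simp only: mult.commute)
    qed
    have "sqrt 2 * (norm (T z))\<^sup>2 \<le> Re (hyp_dir u * cinner (T (T z) + z) (T z))"
      by (rule hyperbola_form[OF T S u])
    then have "1 / sqrt 2 * (sqrt 2 * (norm (T z))\<^sup>2) \<le> 1 / sqrt 2 * Re (hyp_dir u * cinner (T (T z) + z) (T z))"
      by (intro mult_left_mono) auto
    also have "1 / sqrt 2 * Re (hyp_dir u * cinner (T (T z) + z) (T z))
        = Re (hyp_dir u * (s * cinner (T (T z) + z) (T z)))"
      unfolding s_def mult.left_commute[of "hyp_dir u"] by (simp only: times_complex.sel Re_complex_of_real Im_complex_of_real)
    finally show "(norm (\<rho> *\<^sub>C y + \<nu> *\<^sub>C b1))\<^sup>2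
      \<le> Re (hyp_dir u * cinner (\<rho> *\<^sub>C b1 + \<nu> *\<^sub>C b2) (\<rho> *\<^sub>C y + \<nu> *\<^sub>C b1))"
      unfolding 1 2 cinner_scaleC_left by simp
  next
    show "Re (cinner (b2 - y) y) \<le> 0" unfolding b2y cinner_scaleC_left using neg by simp
  qed
  then show ?thesis unfolding b2y cinner_scaleC_left norm_scaleC
    by (simp add: power_mult_distrib power_divide norm_divide)
qed

section \<open>Invertibility of the denominator\<close>

lemma bounded_clinearI:
  assumes "\<And>x y. T (x + y) = T x + T y" "\<And>a x. T (a *\<^sub>C x) = a *\<^sub>C T x"
    and "\<And>x. norm (T x) \<le> norm (x::'a::complex_inner) * K"
  shows "bounded_clinear T"
  unfolding bounded_clinear_def
proof
  show "bounded_linear T"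
    by (rule bounded_linear_intro[OF assms(1) _ assms(3)]) (simp add: scaleR_scaleC assms(2))
qed (use assms(2) in blast)

lemma bounded_clinear_compose:
  assumes "bounded_clinear S" "bounded_clinear T"
  shows "bounded_clinear (S \<circ> T)"
  using assms unfolding bounded_clinear_def
  by (auto simp: o_def intro: bounded_linear_compose)

lemma bounded_clinear_shift:
  assumes T: "bounded_clinear (T :: 'a::complex_inner \<Rightarrow> 'a)"
  shows "bounded_clinear (\<lambda>x. a *\<^sub>C (T x + b *\<^sub>C x))"
proof -
  obtain K where K: "\<And>x. norm (T x) \<le> norm x * K"
    using bounded_linear.bounded[OF bounded_clinearD(5)[OF T]] by blast
  show ?thesis
  proof (rule bounded_clinearI)
    fix x
    have "norm (a *\<^sub>C (T x + b *\<^sub>C x)) \<le> cmod a * (norm x * K + cmod b * norm x)"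
      unfolding norm_scaleC using K norm_triangle_ineq[of "T x" "b *\<^sub>C x"]
      by (intro mult_left_mono) (auto simp: norm_scaleC intro: order_trans)
    then show "norm (a *\<^sub>C (T x + b *\<^sub>C x)) \<le> norm x * (cmod a * (K + cmod b))" by (simp add: algebra_simps)
  qed (simp_all add: bounded_clinearD(1,3)[OF T] scaleC_add_right scaleC_scaleC mult_ac add_ac)
qed

lemma boundedly_invertible_compose:
  assumes "boundedly_invertible S" "boundedly_invertible T"
  shows "boundedly_invertible (S \<circ> T)"
proof -
  obtain S' T' where "bounded_clinear S'" "S' \<circ> S = id" "S \<circ> S' = id"
    "bounded_clinear T'" "T' \<circ> T = id" "T \<circ> T' = id"
    using assms unfolding boundedly_invertible_def by blast
  then have "bounded_clinear (T' \<circ> S')" "(T' \<circ> S') \<circ> (S \<circ> T) = id" "(S \<circ> T) \<circ> (T' \<circ> S') = id"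
    by (simp_all add: bounded_clinear_compose fun_eq_iff)
  then show ?thesis unfolding boundedly_invertible_def by blast
qed

text \<open>
  The Lax-Milgram lemma: for small \<open>\<tau> > 0\<close> the map \<open>x \<mapsto> x - \<tau> (M x - z)\<close> is a contraction, and its
  fixed point solves \<open>M x = z\<close>.
\<close>

lemma coercive_boundedly_invertible:
  fixes M :: "'a::chilbert_space \<Rightarrow> 'a"
  assumes M: "bounded_clinear M" and \<epsilon>: "0 < \<epsilon>"
    and coercive: "\<And>x. \<epsilon> * (norm x)\<^sup>2 \<le> Re (cinner (M x) x)"
  shows "boundedly_invertible M"
proof -
  note M' = bounded_clinearD(1-3)[OF M]
  obtain K0 where K0: "K0 > 0" "\<And>x. norm (M x) \<le> norm x * K0"
    using bounded_linear.pos_bounded[OF bounded_clinearD(5)[OF M]] by blast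
  \<comment> \<open>Adding \<open>\<epsilon>\<close> ensures \<open>\<epsilon> < K\<close> even on the trivial space.\<close>
  define K where "K = K0 + \<epsilon>"
  have K: "\<epsilon> < K" "0 < K" using K0(1) \<epsilon> by (simp_all add: K_def)
  have KM: "norm (M x) \<le> norm x * K" for x
    using K0(2)[of x] \<epsilon> by (simp add: K_def distrib_left add_increasing2)
  have lower: "\<epsilon> * norm x \<le> norm (M x)" for x
  proof (cases "x = 0")
    case False
    have "norm x * (\<epsilon> * norm x) = \<epsilon> * (norm x)\<^sup>2" by (simp add: power2_eq_square)
    also have "\<dots> \<le> norm x * norm (M x)"
      using order_trans[OF coercive Re_cinner_le] by (simp add: mult.commute)
    finally have "norm x * (\<epsilon> * norm x) \<le> norm x * norm (M x)" .
    moreover have "0 < norm x" using False by simp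
    ultimately show ?thesis by (simp only: mult_le_cancel_left_pos)
  qed simp
  have inj: "x = x'" if "M x = M x'" for x x'
  proof -
    have "M (x - x') = 0" using that by (simp add: M')
    then have "\<epsilon> * norm (x - x') \<le> 0" using lower[of "x - x'"] by simp
    then show ?thesis using \<epsilon> by (simp add: mult_le_0_iff)
  qed
  \<comment> \<open>The minimiser of \<open>1 - 2 \<tau> \<epsilon> + \<tau>\<^sup>2 K\<^sup>2\<close>, which bounds the square of the Lipschitz constant; the minimum is \<open>q\<^sup>2\<close>.\<close>
  define \<tau> where "\<tau> = \<epsilon> / K\<^sup>2"
  define q where "q = sqrt (1 - \<epsilon>\<^sup>2 / K\<^sup>2)"
  have \<epsilon>K: "0 < \<epsilon>\<^sup>2 / K\<^sup>2" "\<epsilon>\<^sup>2 / K\<^sup>2 < 1"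
    using \<epsilon> K power_strict_mono[of \<epsilon> K 2] by simp_all
  have q: "0 \<le> q" "q < 1" "q\<^sup>2 = 1 - \<epsilon>\<^sup>2 / K\<^sup>2"
  proof -
    have "0 \<le> 1 - \<epsilon>\<^sup>2 / K\<^sup>2" using \<epsilon>K(2) by linarith
    then show "0 \<le> q" "q\<^sup>2 = 1 - \<epsilon>\<^sup>2 / K\<^sup>2"
      unfolding q_def by (rule real_sqrt_ge_zero, rule real_sqrt_pow2)
    have "sqrt (1 - \<epsilon>\<^sup>2 / K\<^sup>2) < sqrt 1" using \<epsilon>K(1) by (intro real_sqrt_less_mono) linarith
    then show "q < 1" by (simp add: q_def)
  qed
  have contract: "norm (d + (- complex_of_real \<tau>) *\<^sub>C M d) \<le> q * norm d" for d
  proof (rule power2_le_imp_le)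
    have e: "Re (1 * cnj (- complex_of_real \<tau>) * cinner d (M d)) = - \<tau> * Re (cinner (M d) d)"
      by (subst cinner_commute) simp
    have "(norm (1 *\<^sub>C d + (- complex_of_real \<tau>) *\<^sub>C M d))\<^sup>2
        = (norm d)\<^sup>2 + \<tau>\<^sup>2 * (norm (M d))\<^sup>2 - 2 * \<tau> * Re (cinner (M d) d)"
      unfolding norm_scaleC_add e by simp
    also have "\<dots> \<le> (norm d)\<^sup>2 + \<tau>\<^sup>2 * (norm d * K)\<^sup>2 - 2 * \<tau> * (\<epsilon> * (norm d)\<^sup>2)"
    proof -
      have "(norm (M d))\<^sup>2 \<le> (norm d * K)\<^sup>2" using KM[of d] by (rule power_mono) simp
      then have "\<tau>\<^sup>2 * (norm (M d))\<^sup>2 \<le> \<tau>\<^sup>2 * (norm d * K)\<^sup>2" by (rule mult_left_mono) simp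
      moreover have "2 * \<tau> * (\<epsilon> * (norm d)\<^sup>2) \<le> 2 * \<tau> * Re (cinner (M d) d)"
        using coercive[of d] by (rule mult_left_mono) (use \<epsilon> in \<open>simp add: \<tau>_def\<close>)
      ultimately show ?thesis by linarith
    qed
    also have "\<dots> = (q * norm d)\<^sup>2"
      unfolding power_mult_distrib q(3) \<tau>_def using K by (simp add: field_simps power2_eq_square)
    finally show "(norm (d + (- complex_of_real \<tau>) *\<^sub>C M d))\<^sup>2 \<le> (q * norm d)\<^sup>2" by (simp only: scaleC_one)
  qed (use q in simp)
  have surj: "\<exists>x. M x = z" for z
  proof -
    define F where "F x = x + (- complex_of_real \<tau>) *\<^sub>C (M x - z)" for x
    have "\<exists>!x. F x = x"
    proof (rule banach_fix_type[OF q(1,2)], intro allI)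
      fix x y
      have "F x - F y = (x - y) + (- complex_of_real \<tau>) *\<^sub>C M (x - y)"
        unfolding F_def M' scaleC_diff_right by simp
      then show "dist (F x) (F y) \<le> q * dist x y" unfolding dist_norm using contract[of "x - y"] by simp
    qed
    then obtain x where "F x = x" by blast
    then have "(- complex_of_real \<tau>) *\<^sub>C (M x - z) = 0" by (simp add: F_def)
    then have "cmod (- complex_of_real \<tau>) * norm (M x - z) = 0" by (metis norm_scaleC norm_zero)
    then show ?thesis using \<epsilon> K by (auto simp: \<tau>_def)
  qed
  define S where "S = inv M"
  have "inj M" using inj by (rule injI)
  then have SM: "S (M x) = x" for x unfolding S_def by (rule inv_f_f)
  have MS: "M (S z) = z" for z unfolding S_def using surj by (metis f_inv_into_f rangeI)
  have "bounded_clinear S"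
  proof (rule bounded_clinearI)
    show "S (x + y) = S x + S y" for x y by (rule inj) (simp add: M' MS)
    show "S (a *\<^sub>C x) = a *\<^sub>C S x" for a x by (rule inj) (simp add: M' MS)
    show "norm (S x) \<le> norm x * (1 / \<epsilon>)" for x
      using lower[of "S x"] \<epsilon> unfolding MS by (simp add: field_simps)
  qed
  then show ?thesis unfolding boundedly_invertible_def using SM MS by (auto simp: fun_eq_iff)
qed

lemma boundedly_invertible_scaleC:
  assumes "a \<noteq> 0"
  shows "boundedly_invertible (\<lambda>x::'a::complex_inner. a *\<^sub>C x)"
proof -
  have "bounded_clinear (\<lambda>x::'a. b *\<^sub>C x)" for b
    by (rule bounded_clinearI[of _ "cmod b"]) (simp_all add: scaleC_add_right scaleC_scaleC mult.commute norm_scaleC)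
  moreover have "(\<lambda>x::'a. (1 / a) *\<^sub>C x) \<circ> (\<lambda>x. a *\<^sub>C x) = id" "(\<lambda>x::'a. a *\<^sub>C x) \<circ> (\<lambda>x. (1 / a) *\<^sub>C x) = id"
    using assms by (simp_all add: fun_eq_iff scaleC_scaleC scaleC_one)
  ultimately show ?thesis unfolding boundedly_invertible_def by blast
qed

text \<open>
  The number \<open>- b\<close> is separated from the sector by one of its boundary rays; multiplication by \<open>\<theta>\<close>
  turns that ray into the imaginary axis and makes the operator coercive.
\<close>

lemma shift_boundedly_invertible:
  fixes T :: "'a::chilbert_space \<Rightarrow> 'a"
  assumes T: "bounded_clinear T" and S: "\<And>x. \<bar>Im (cinner (T x) x)\<bar> \<le> Re (cinner (T x) x)"
    and b: "\<bar>Re b\<bar> < \<bar>Im b\<bar>"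
  shows "boundedly_invertible (\<lambda>x. T x + b *\<^sub>C x)"
proof -
  define \<theta> where "\<theta> = (if Im b < 0 then Complex 1 1 else Complex 1 (-1))"
  have \<theta>: "\<theta> \<noteq> 0" by (simp add: \<theta>_def complex_eq_iff)
  define \<epsilon> where "\<epsilon> = Re (\<theta> * b)"
  have \<epsilon>: "\<epsilon> > 0" using b by (auto simp: \<epsilon>_def \<theta>_def)
  have "boundedly_invertible (\<lambda>x. \<theta> *\<^sub>C (T x + b *\<^sub>C x))"
  proof (rule coercive_boundedly_invertible[OF bounded_clinear_shift[OF T] \<epsilon>])
    fix x
    have "0 \<le> Re (\<theta> * cinner (T x) x)" using S[of x] by (auto simp: \<theta>_def)
    then show "\<epsilon> * (norm x)\<^sup>2 \<le> Re (cinner (\<theta> *\<^sub>C (T x + b *\<^sub>C x)) x)"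
      unfolding cinner_expand cinner_self by (simp add: \<epsilon>_def algebra_simps)
  qed
  from boundedly_invertible_compose[OF boundedly_invertible_scaleC this, of "1 / \<theta>"] \<theta>
  show ?thesis by (simp add: o_def scaleC_scaleC scaleC_one)
qed

text \<open>
  The square roots of a number in the left half-plane lie outside the sector, so both factors of
  \<open>T\<^sup>2 - \<rho> = (T + \<sigma>) (T - \<sigma>)\<close> are invertible.
\<close>

lemma square_shift_boundedly_invertible:
  fixes T :: "'a::chilbert_space \<Rightarrow> 'a"
  assumes T: "bounded_clinear T" and S: "\<And>x. \<bar>Im (cinner (T x) x)\<bar> \<le> Re (cinner (T x) x)"
    and \<rho>: "Re \<rho> < 0"
  shows "boundedly_invertible (\<lambda>x. T (T x) + (- \<rho>) *\<^sub>C x)"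
proof -
  define \<sigma> where "\<sigma> = csqrt \<rho>"
  have \<sigma>2: "\<sigma> * \<sigma> = \<rho>" unfolding \<sigma>_def by (metis power2_csqrt power2_eq_square)
  have "Re \<rho> = (Re \<sigma>)\<^sup>2 - (Im \<sigma>)\<^sup>2" unfolding \<sigma>2[symmetric] by (simp add: power2_eq_square)
  then have "(Re \<sigma>)\<^sup>2 < (Im \<sigma>)\<^sup>2" using \<rho> by simp
  then have \<sigma>: "\<bar>Re \<sigma>\<bar> < \<bar>Im \<sigma>\<bar>" by (metis abs_le_square_iff not_le)
  have "boundedly_invertible ((\<lambda>x. T x + \<sigma> *\<^sub>C x) \<circ> (\<lambda>x. T x + (- \<sigma>) *\<^sub>C x))"
    by (intro boundedly_invertible_compose shift_boundedly_invertible[OF T S]) (use \<sigma> in auto)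
  moreover have "(\<lambda>x. T x + \<sigma> *\<^sub>C x) \<circ> (\<lambda>x. T x + (- \<sigma>) *\<^sub>C x) = (\<lambda>x. T (T x) + (- \<rho>) *\<^sub>C x)"
  proof
    fix x
    have "(- \<sigma>) *\<^sub>C T x + \<sigma> *\<^sub>C T x = 0"
      unfolding scaleC_add_left[symmetric] by (simp add: scaleC_zero_left)
    then show "((\<lambda>x. T x + \<sigma> *\<^sub>C x) \<circ> (\<lambda>x. T x + (- \<sigma>) *\<^sub>C x)) x = T (T x) + (- \<rho>) *\<^sub>C x"
      by (simp add: bounded_clinearD(1,3)[OF T] scaleC_add_right scaleC_scaleC \<sigma>2 add.assoc)
  qed
  ultimately show ?thesis by simp
qed

section \<open>The rational functions\<close>

text \<open>
  A zero would satisfy \<open>|z + 1|\<^sup>2 = |c| |z - 1|\<^sup>2\<close>, but \<open>|z - 1| \<le> |z + 1|\<close> in the right half-plane.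
\<close>

lemma den_fun_nonzero:
  assumes c: "cmod c < 1" and z: "0 \<le> Re z"
  shows "den_fun c z \<noteq> 0"
proof
  assume "den_fun c z = 0"
  then have "(z + 1)\<^sup>2 = - (c * (z - 1)\<^sup>2)" unfolding den_fun_def by (simp add: eq_neg_iff_add_eq_0)
  then have "cmod ((z + 1)\<^sup>2) = cmod (c * (z - 1)\<^sup>2)" by (metis norm_minus_cancel)
  then have eq: "(cmod (z + 1))\<^sup>2 = cmod c * (cmod (z - 1))\<^sup>2" by (simp add: norm_mult norm_power)
  have "(cmod (z + 1))\<^sup>2 - (cmod (z - 1))\<^sup>2 = 4 * Re z"
    unfolding cmod_power2 by (simp add: power2_eq_square algebra_simps)
  then have le: "(cmod (z - 1))\<^sup>2 \<le> (cmod (z + 1))\<^sup>2" using z by linarith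
  have pos: "0 < (cmod (z + 1))\<^sup>2" using z by (auto simp: complex_eq_iff)
  have "cmod c * (cmod (z - 1))\<^sup>2 \<le> cmod c * (cmod (z + 1))\<^sup>2" using le by (intro mult_left_mono) auto
  also have "\<dots> < 1 * (cmod (z + 1))\<^sup>2" using c pos by (intro mult_strict_right_mono) auto
  finally show False using eq by simp
qed

lemma one_plus_nonzero: "cmod c < 1 \<Longrightarrow> 1 + c \<noteq> 0"
  by (metis add.inverse_unique norm_minus_cancel norm_one less_irrefl)

lemma den_fun_factor:
  assumes c: "cmod c < 1"
  obtains \<rho>1 \<rho>2 where "Re \<rho>1 < 0" "Re \<rho>2 < 0" "(1 + c) * (\<rho>1 + \<rho>2) = - (2 * (1 - c))" "\<rho>1 * \<rho>2 = 1"
    "\<And>z. den_fun c z = (1 + c) * (z - \<rho>1) * (z - \<rho>2)"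
proof -
  have c1: "1 + c \<noteq> 0" using c by (rule one_plus_nonzero)
  define k where "k = (1 - c) / (1 + c)"
  define w where "w = csqrt (k\<^sup>2 - 1)"
  have w: "w * w = k\<^sup>2 - 1" unfolding w_def by (metis power2_csqrt power2_eq_square)
  define \<rho>1 where "\<rho>1 = - k + w"
  define \<rho>2 where "\<rho>2 = - k - w"
  have s: "\<rho>1 + \<rho>2 = - 2 * k" by (simp add: \<rho>1_def \<rho>2_def)
  have p: "\<rho>1 * \<rho>2 = 1" using w by (simp add: \<rho>1_def \<rho>2_def algebra_simps power2_eq_square)
  have ck: "(1 + c) * k = 1 - c" using c1 by (simp add: k_def)
  have s': "(1 + c) * (\<rho>1 + \<rho>2) = - (2 * (1 - c))" 
  proof -
    have "(1 + c) * (- 2 * k) = - 2 * ((1 + c) * k)" by simp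
    then show ?thesis unfolding s ck by simp
  qed
  have f: "den_fun c z = (1 + c) * (z - \<rho>1) * (z - \<rho>2)" for z
  proof -
    have "(1 + c) * (z - \<rho>1) * (z - \<rho>2) = (1 + c) * (z * z) - (1 + c) * (\<rho>1 + \<rho>2) * z + (1 + c) * (\<rho>1 * \<rho>2)"
      by (simp add: algebra_simps)
    also have "\<dots> = den_fun c z" unfolding s' p den_fun_def by (simp add: algebra_simps power2_eq_square)
    finally show ?thesis ..
  qed
  have "den_fun c \<rho>1 = 0" "den_fun c \<rho>2 = 0" by (simp_all add: f)
  then have "Re \<rho>1 < 0" "Re \<rho>2 < 0" using den_fun_nonzero[OF c] by (metis not_le)+
  then show ?thesis using that s' p f by blast
qed

text \<open>
  The numerator is the reflection of the denominator in the imaginary axis, so its zeros mirror the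
  poles; this is what makes the quotient a Blaschke product.
\<close>

lemma num_fun_reflect: "num_fun c z = cnj (den_fun c (- cnj z))"
  by (simp add: num_fun_def den_fun_def power2_eq_square algebra_simps)

lemma blaschke_num_den:
  assumes c: "cmod c < 1"
  shows "blaschke2_on_rhp (\<lambda>z. num_fun c z / den_fun c z)"
proof -
  obtain \<rho>1 \<rho>2 where \<rho>: "Re \<rho>1 < 0" "Re \<rho>2 < 0" and f: "\<And>z. den_fun c z = (1 + c) * (z - \<rho>1) * (z - \<rho>2)"
    using den_fun_factor[OF c] by metis
  have c1: "1 + c \<noteq> 0" using c by (rule one_plus_nonzero)
  define \<omega> where "\<omega> = cnj (1 + c) / (1 + c)"
  have "cmod \<omega> = 1" unfolding \<omega>_def norm_divide complex_mod_cnj using c1 by simp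
  moreover have num: "num_fun c z = cnj (1 + c) * (z + cnj \<rho>1) * (z + cnj \<rho>2)" for z
    by (simp add: num_fun_reflect f algebra_simps)
  have "num_fun c z / den_fun c z
      = \<omega> * ((z - (- cnj \<rho>1)) / (z + cnj (- cnj \<rho>1))) * ((z - (- cnj \<rho>2)) / (z + cnj (- cnj \<rho>2)))" for z
    unfolding num f \<omega>_def by simp
  ultimately show ?thesis unfolding blaschke2_on_rhp_def using \<rho>
    by (intro exI[of _ \<omega>] exI[of _ "- cnj \<rho>1"] exI[of _ "- cnj \<rho>2"]) simp
qed

lemma zeros_at_half_i:
  "{z. den_fun (\<i> / 2) z \<noteq> 0 \<and> num_fun (\<i> / 2) z / den_fun (\<i> / 2) z = 0} = {1 + 2 * \<i>, (1 - 2 * \<i>) / 5}"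
proof -
  have num: "num_fun (\<i> / 2) z = (1 - \<i> / 2) * (z - (1 + 2 * \<i>)) * (z - (1 - 2 * \<i>) / 5)" for z
    
  proof -
    have roots: "(1 - \<i> / 2) * ((1 + 2 * \<i>) + (1 - 2 * \<i>) / 5) = 2 + \<i>" "(1 + 2 * \<i>) * ((1 - 2 * \<i>) / 5) = 1"
      by (simp_all add: complex_eq_iff)
    have expand: "a * (z - p) * (z - q) = a * z\<^sup>2 - a * (p + q) * z + a * (p * q)" for a p q :: complex
      by (simp add: power2_eq_square algebra_simps)
    have "num_fun (\<i> / 2) z = (1 - \<i> / 2) * z\<^sup>2 - (2 + \<i>) * z + (1 - \<i> / 2) * 1"
      unfolding num_fun_def by (simp add: power2_eq_square algebra_simps)
    then show ?thesis unfolding expand roots .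
  qed
  have ne: "1 \<noteq> \<i> / 2" by (simp add: complex_eq_iff)
  have den: "den_fun (\<i> / 2) z \<noteq> 0" if "0 \<le> Re z" for z
    by (rule den_fun_nonzero[OF _ that]) (simp add: norm_divide)
  have "num_fun (\<i> / 2) z = 0 \<longleftrightarrow> z = 1 + 2 * \<i> \<or> z = (1 - 2 * \<i>) / 5" for z
    unfolding num mult_eq_0_iff right_minus_eq using ne by blast
  moreover have "den_fun (\<i> / 2) (1 + 2 * \<i>) \<noteq> 0" "den_fun (\<i> / 2) ((1 - 2 * \<i>) / 5) \<noteq> 0"
    by (rule den, simp)+
  ultimately show ?thesis unfolding divide_eq_0_iff by blast
qed

section \<open>The operators in the theorem\<close>

lemma num_op_square:
  assumes T: "bounded_clinear T"
  shows "num_op c (T ^^ 2) x = (1 + cnj c) *\<^sub>C (T (T (T (T x))) + x) + (- (2 * (1 - cnj c))) *\<^sub>C T (T x)"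
proof -
  define y where "y = T (T x)"
  define h where "h = T (T y) + x"
  have two: "2 *\<^sub>C v = v + v" for v :: 'a
    using scaleC_add_left[of 1 1 v] by (simp add: scaleC_one)
  have "num_op c (T ^^ 2) x = (h - (y + y)) + cnj c *\<^sub>C (h + (y + y))"
    by (simp add: num_op_def numeral_2_eq_2 bounded_clinearD(1,2)[OF T] y_def h_def algebra_simps)
  also have "\<dots> = (1 + cnj c) *\<^sub>C h + (- (2 * (1 - cnj c))) *\<^sub>C y"
  proof -
    have "(- (2 * (1 - cnj c))) *\<^sub>C y = (-1) *\<^sub>C (2 *\<^sub>C y) + cnj c *\<^sub>C (2 *\<^sub>C y)"
      unfolding scaleC_scaleC scaleC_add_left[symmetric] by (simp add: algebra_simps)
    then show ?thesis
      unfolding two scaleC_add_left[of 1] scaleC_add_right[of _ h] scaleC_one scaleC_minus_one by simp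
  qed
  finally show ?thesis by (simp add: h_def y_def)
qed

lemma den_op_square:
  assumes T: "bounded_clinear T"
  shows "den_op c (T ^^ 2) x = (1 + c) *\<^sub>C (T (T (T (T x))) + x) + (2 * (1 - c)) *\<^sub>C T (T x)"
proof -
  define y where "y = T (T x)"
  define h where "h = T (T y) + x"
  have two: "2 *\<^sub>C v = v + v" for v :: 'a
    using scaleC_add_left[of 1 1 v] by (simp add: scaleC_one)
  have "den_op c (T ^^ 2) x = (h + (y + y)) + c *\<^sub>C (h - (y + y))"
    by (simp add: den_op_def numeral_2_eq_2 bounded_clinearD(1,2)[OF T] y_def h_def algebra_simps)
  also have "\<dots> = (1 + c) *\<^sub>C h + (2 * (1 - c)) *\<^sub>C y"
  proof -
    have "(2 * (1 - c)) *\<^sub>C y = 2 *\<^sub>C y + (- c) *\<^sub>C (2 *\<^sub>C y)"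
      unfolding scaleC_scaleC scaleC_add_left[symmetric] by (simp add: algebra_simps)
    moreover have "(- c) *\<^sub>C v = - (c *\<^sub>C v)" for v :: 'a
      using scaleC_scaleC[of "-1" c v] by (simp add: scaleC_minus_one)
    ultimately show ?thesis
      unfolding two scaleC_add_left[of 1] scaleC_diff_right scaleC_one by simp
  qed
  finally show ?thesis by (simp add: h_def y_def)
qed

lemma den_op_boundedly_invertible:
  fixes T :: "'a::chilbert_space \<Rightarrow> 'a"
  assumes T: "bounded_clinear T" and S: "\<And>x. \<bar>Im (cinner (T x) x)\<bar> \<le> Re (cinner (T x) x)"
    and c: "cmod c < 1"
  shows "boundedly_invertible (den_op c (T ^^ 2))"
proof -
  obtain \<rho>1 \<rho>2 where \<rho>: "Re \<rho>1 < 0" "Re \<rho>2 < 0" and s: "(1 + c) * (\<rho>1 + \<rho>2) = - (2 * (1 - c))"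
    and p: "\<rho>1 * \<rho>2 = 1"
    using den_fun_factor[OF c] by metis
  have c1: "1 + c \<noteq> 0" using c by (rule one_plus_nonzero)
  define Q where "Q \<rho> x = T (T x) + (- \<rho>) *\<^sub>C x" for \<rho> x
  have "boundedly_invertible (Q \<rho>1)" "boundedly_invertible (Q \<rho>2)"
    unfolding Q_def by (intro square_shift_boundedly_invertible[OF T S] \<rho>)+
  then have "boundedly_invertible ((\<lambda>x. (1 + c) *\<^sub>C x) \<circ> (Q \<rho>1 \<circ> Q \<rho>2))"
    using c1 by (intro boundedly_invertible_compose boundedly_invertible_scaleC) auto
  moreover have "(\<lambda>x. (1 + c) *\<^sub>C x) \<circ> (Q \<rho>1 \<circ> Q \<rho>2) = den_op c (T ^^ 2)"
  proof
    fix x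
    define y where "y = T (T x)"
    have "Q \<rho>1 (Q \<rho>2 x) = T (T y) + ((- \<rho>2) *\<^sub>C y + (- \<rho>1) *\<^sub>C y) + x"
      unfolding Q_def bounded_clinearD(1,3)[OF T] y_def scaleC_add_right scaleC_scaleC
      by (simp add: p scaleC_one add_ac)
    also have "(- \<rho>2) *\<^sub>C y + (- \<rho>1) *\<^sub>C y = (- (\<rho>1 + \<rho>2)) *\<^sub>C y"
      unfolding scaleC_add_left[symmetric] by (rule arg_cong[where f="\<lambda>t. t *\<^sub>C y"]) simp
    finally have "(1 + c) *\<^sub>C Q \<rho>1 (Q \<rho>2 x) = (1 + c) *\<^sub>C (T (T y) + x) + ((1 + c) * - (\<rho>1 + \<rho>2)) *\<^sub>C y"
      by (simp only: scaleC_add_right scaleC_scaleC add_ac)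
    also have "(1 + c) * - (\<rho>1 + \<rho>2) = 2 * (1 - c)" using s by (simp only: mult_minus_right) simp
    finally show "((\<lambda>x. (1 + c) *\<^sub>C x) \<circ> (Q \<rho>1 \<circ> Q \<rho>2)) x = den_op c (T ^^ 2) x"
      unfolding den_op_square[OF T] y_def by simp
  qed
  ultimately show ?thesis by simp
qed

theorem theorem1p7:
  fixes c :: complex
  assumes "cmod c \<le> 19 / 20"
  shows "(\<forall>T :: 'a::chilbert_space \<Rightarrow> 'a.
            bounded_clinear T \<longrightarrow> numerical_range T \<subseteq> sector (pi / 4) \<longrightarrow>
              boundedly_invertible (den_op c (T ^^ 2)) \<and>
              onorm (num_op c (T ^^ 2) \<circ> inv (den_op c (T ^^ 2))) \<le> sqrt 2)
       \<and> (\<forall>z. 0 < Re z \<longrightarrow> den_fun c z \<noteq> 0)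
       \<and> blaschke2_on_rhp (\<lambda>z. num_fun c z / den_fun c z)
       \<and> {z. den_fun (\<i> / 2) z \<noteq> 0 \<and> num_fun (\<i> / 2) z / den_fun (\<i> / 2) z = 0}
           = {1 + 2 * \<i>, (1 - 2 * \<i>) / 5}"
proof (intro conjI allI impI)
  have c: "cmod c < 1" using assms by simp
  show "blaschke2_on_rhp (\<lambda>z. num_fun c z / den_fun c z)" by (rule blaschke_num_den[OF c])
  show "den_fun c z \<noteq> 0" if "0 < Re z" for z using den_fun_nonzero[OF c] that by simp
  fix T :: "'a \<Rightarrow> 'a"
  assume T: "bounded_clinear T" and W: "numerical_range T \<subseteq> sector (pi / 4)"
  note S = numerical_range_sector[OF T W]
  show inv: "boundedly_invertible (den_op c (T ^^ 2))" by (rule den_op_boundedly_invertible[OF T S c])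
  show "onorm (num_op c (T ^^ 2) \<circ> inv (den_op c (T ^^ 2))) \<le> sqrt 2"
  proof (rule onorm_bound)
    fix z
    obtain R where "den_op c (T ^^ 2) \<circ> R = id" using inv unfolding boundedly_invertible_def by blast
    then have "surj (den_op c (T ^^ 2))" by (metis comp_eq_dest_lhs id_apply surjI)
    then have x: "den_op c (T ^^ 2) (inv (den_op c (T ^^ 2)) z) = z" by (rule surj_f_inv_f)
    define x where "x = inv (den_op c (T ^^ 2)) z"
    have "(norm (num_op c (T ^^ 2) x))\<^sup>2 \<le> 2 * (norm (den_op c (T ^^ 2) x))\<^sup>2"
      unfolding num_op_square[OF T] den_op_square[OF T]
      by (rule moebius_norm_estimate) (use c sector_estimate[OF T S] in auto)
    then have "(norm (num_op c (T ^^ 2) x))\<^sup>2 \<le> (sqrt 2 * norm z)\<^sup>2"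
      using x by (simp add: x_def power_mult_distrib)
    then have "norm (num_op c (T ^^ 2) x) \<le> sqrt 2 * norm z" by (rule power2_le_imp_le) simp
    then show "norm ((num_op c (T ^^ 2) \<circ> inv (den_op c (T ^^ 2))) z) \<le> sqrt 2 * norm z"
      by (simp add: x_def)
  qed simp
qed (rule zeros_at_half_i)

end
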